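(* Let $(\Omega,\mathcal{F},\mu)$ be a probability space, let $\mathcal{F}_1,\dots,\mathcal{F}_n$ be sub-$\sigma$-algebras of $\mathcal{F}$, and let $p\in[1,\infty)\cup\{\infty\}$. Define the $n\times n$ matrix $E=(e_{ij})$ by $e_{ii}=0$ and $e_{ij}=1-\psi'(\mathcal{F}_i,\mathcal{F}_j)$ for $i\neq j$, and let $r(E)$ be its spectral radius. If $r(E)<1$, then the marginal subspaces $L^p_0(\mathcal{F}_1),\dots,L^p_0(\mathcal{F}_n)$ are linearly independent and their sum $L^p_0(\mathcal{F}_1)+\dots+L^p_0(\mathcal{F}_n)$ is complemented in $L^p(\mathcal{F})$.
   Context: Let $\mathbb{K}$ be $\mathbb{R}$ or $\mathbb{C}$. $L^p(\mathcal{F})=L^p(\Omega,\mathcal{F},\mu)$ is the usual Banach space of ($\mu$-a.e. equivalence classes of) $\mathbb{K}$-valued random variables. For a sub-$\sigma$-algebra $\mathcal{A}$ of $\mathcal{F}$, $L^p(\mathcal{A})$ is the subspace of those elements of $L^p(\mathcal{F})$ that contain at least one $\mathcal{A}$-measurable random variable, and $L^p_0(\mathcal{A})=\{\xi\in L^p(\mathcal{A})\mid E\xi=0\}$, where $E\xi$ is the expectation of $\xi$. For sub-$\sigma$-algebras $\mathcal{A},\mathcal{B}$ of $\mathcal{F}$, $$\psi'(\mathcal{A},\mathcal{B})=\inf\left\{\frac{\mu(A\cap B)}{\mu(A)\mu(B)}\;\Big|\;A\in\mathcal{A},\ B\in\mathcal{B},\ \mu(A)>0,\ \mu(B)>0\right\}.$$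 One has $0\leqslant\psi'(\mathcal{A},\mathcal{B})\leqslant 1$. A subspace $M$ of a Banach space $X$ is complemented in $X$ if there is a continuous linear projection of $X$ onto $M$. Subspaces $X_1,\dots,X_n$ are linearly independent if $x_1+\dots+x_n=0$ with $x_i\in X_i$ implies all $x_i=0$. *)

theory Defs
  imports "HOL-Probability.Probability" "Jordan_Normal_Form.Spectral_Radius"
begin

section \<open>Almost-everywhere equivalence classes\<close>

definition ae_class ::
    "'a measure \<Rightarrow> ('a \<Rightarrow> 'k::{banach, second_countable_topology}) \<Rightarrow> ('a \<Rightarrow> 'k) set" where
  "ae_class M f = {g \<in> borel_measurable M. AE x in M. g x = f x}"

definition ae_rep :: "('a \<Rightarrow> 'k) set \<Rightarrow> 'a \<Rightarrow> 'k" where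
  "ae_rep X = (SOME f. f \<in> X)"

text \<open>The operations on classes are defined on chosen representatives; the lemmas below show that
  the choice does not matter.\<close>

definition ae_zero ::
    "'a measure \<Rightarrow> ('a \<Rightarrow> 'k::{banach, second_countable_topology}) set" where
  "ae_zero M = ae_class M (\<lambda>x. 0)"

definition ae_add ::
    "'a measure \<Rightarrow> ('a \<Rightarrow> 'k::{banach, second_countable_topology}) set \<Rightarrow> ('a \<Rightarrow> 'k) set
      \<Rightarrow> ('a \<Rightarrow> 'k) set" where
  "ae_add M X Y = ae_class M (\<lambda>x. ae_rep X x + ae_rep Y x)"

definition ae_diff ::
    "'a measure \<Rightarrow> ('a \<Rightarrow> 'k::{banach, second_countable_topology}) set \<Rightarrow> ('a \<Rightarrow> 'k) set
      \<Rightarrow> ('a \<Rightarrow> 'k) set" where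
  "ae_diff M X Y = ae_class M (\<lambda>x. ae_rep X x - ae_rep Y x)"

definition ae_scale ::
    "'a measure \<Rightarrow> 'k::{real_normed_field, banach, second_countable_topology} \<Rightarrow> ('a \<Rightarrow> 'k) set
      \<Rightarrow> ('a \<Rightarrow> 'k) set" where
  "ae_scale M c X = ae_class M (\<lambda>x. c * ae_rep X x)"

definition ae_sum ::
    "'a measure \<Rightarrow> 'i set \<Rightarrow> ('i \<Rightarrow> ('a \<Rightarrow> 'k::{banach, second_countable_topology}) set)
      \<Rightarrow> ('a \<Rightarrow> 'k) set" where
  "ae_sum M I X = ae_class M (\<lambda>x. \<Sum>i\<in>I. ae_rep (X i) x)"


section \<open>The spaces \<open>L\<^sup>p\<close>, for exponents \<open>p\<close> in \<open>[1, \<infinity>]\<close>\<close>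

definition Lp_functions ::
    "'a measure \<Rightarrow> ennreal \<Rightarrow> ('a \<Rightarrow> 'k::{banach, second_countable_topology}) set" where
  "Lp_functions M p = {f \<in> borel_measurable M.
     if p = \<infinity> then esssup M (\<lambda>x. ennreal (norm (f x))) < \<infinity>
     else integrable M (\<lambda>x. norm (f x) powr enn2real p)}"

definition Lp_seminorm ::
    "'a measure \<Rightarrow> ennreal \<Rightarrow> ('a \<Rightarrow> 'k::{banach, second_countable_topology}) \<Rightarrow> real" where
  "Lp_seminorm M p f =
     (if p = \<infinity> then enn2real (esssup M (\<lambda>x. ennreal (norm (f x))))
      else (LINT x|M. norm (f x) powr enn2real p) powr (1 / enn2real p))"

definition Lp ::
    "'a measure \<Rightarrow> ennreal \<Rightarrow> ('a \<Rightarrow> 'k::{banach, second_countable_topology}) set set" where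
  "Lp M p = ae_class M ` Lp_functions M p"

definition Lp_norm ::
    "'a measure \<Rightarrow> ennreal \<Rightarrow> ('a \<Rightarrow> 'k::{banach, second_countable_topology}) set \<Rightarrow> real" where
  "Lp_norm M p X = Lp_seminorm M p (ae_rep X)"

definition Lp_topology ::
    "'a measure \<Rightarrow> ennreal \<Rightarrow> ('a \<Rightarrow> 'k::{banach, second_countable_topology}) set topology" where
  "Lp_topology M p = Metric_space.mtopology (Lp M p) (\<lambda>X Y. Lp_norm M p (ae_diff M X Y))"

text \<open>For a sub-\<open>\<sigma>\<close>-algebra \<open>A\<close>, the members of \<open>Lp_sub M p A\<close> are still classes modulo \<open>M\<close>, that is
  elements of \<open>Lp M p\<close>; only one of the representatives has to be \<open>A\<close>-measurable.\<close>

definition Lp_sub ::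
    "'a measure \<Rightarrow> ennreal \<Rightarrow> 'a measure
      \<Rightarrow> ('a \<Rightarrow> 'k::{banach, second_countable_topology}) set set" where
  "Lp_sub M p A = {X \<in> Lp M p. \<exists>f\<in>X. f \<in> borel_measurable A}"

definition class_expectation ::
    "'a measure \<Rightarrow> ('a \<Rightarrow> 'k::{banach, second_countable_topology}) set \<Rightarrow> 'k" where
  "class_expectation M X = (LINT x|M. ae_rep X x)"

definition Lp0_sub ::
    "'a measure \<Rightarrow> ennreal \<Rightarrow> 'a measure
      \<Rightarrow> ('a \<Rightarrow> 'k::{banach, second_countable_topology}) set set" where
  "Lp0_sub M p A = {X \<in> Lp_sub M p A. class_expectation M X = 0}"


section \<open>Independence, sums and complementation of subspaces\<close>

definition independent_subspaces ::
    "'a measure \<Rightarrow> 'i set \<Rightarrow> ('i \<Rightarrow> ('a \<Rightarrow> 'k::{banach, second_countable_topology}) set set)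
      \<Rightarrow> bool" where
  "independent_subspaces M I S \<longleftrightarrow>
     (\<forall>X. (\<forall>i\<in>I. X i \<in> S i) \<and> ae_sum M I X = ae_zero M \<longrightarrow> (\<forall>i\<in>I. X i = ae_zero M))"

definition sum_of_subspaces ::
    "'a measure \<Rightarrow> 'i set \<Rightarrow> ('i \<Rightarrow> ('a \<Rightarrow> 'k::{banach, second_countable_topology}) set set)
      \<Rightarrow> ('a \<Rightarrow> 'k) set set" where
  "sum_of_subspaces M I S = {ae_sum M I X |X. \<forall>i\<in>I. X i \<in> S i}"

definition Lp_linear ::
    "'a measure \<Rightarrow> ennreal
      \<Rightarrow> (('a \<Rightarrow> 'k::{real_normed_field, banach, second_countable_topology}) set
            \<Rightarrow> ('a \<Rightarrow> 'k) set) \<Rightarrow> bool" where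
  "Lp_linear M p P \<longleftrightarrow>
     (\<forall>X\<in>Lp M p. \<forall>Y\<in>Lp M p. P (ae_add M X Y) = ae_add M (P X) (P Y)) \<and>
     (\<forall>c. \<forall>X\<in>Lp M p. P (ae_scale M c X) = ae_scale M c (P X))"

definition complemented_in_Lp ::
    "'a measure \<Rightarrow> ennreal
      \<Rightarrow> ('a \<Rightarrow> 'k::{real_normed_field, banach, second_countable_topology}) set set
      \<Rightarrow> bool" where
  "complemented_in_Lp M p S \<longleftrightarrow>
     (\<exists>P. continuous_map (Lp_topology M p) (Lp_topology M p) P \<and> Lp_linear M p P \<and>
          (\<forall>X\<in>Lp M p. P (P X) = P X) \<and> P ` Lp M p = S)"


section \<open>The coefficient \<open>\<psi>'\<close>\<close>

definition psi' :: "'a measure \<Rightarrow> 'a measure \<Rightarrow> 'a measure \<Rightarrow> real" where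
  "psi' M A B = Inf {measure M (a \<inter> b) / (measure M a * measure M b) |a b.
     a \<in> sets A \<and> b \<in> sets B \<and> measure M a > 0 \<and> measure M b > 0}"


section \<open>Independence of the choice of representatives\<close>

lemma ae_class_eqI:
  assumes "AE x in M. f x = g x"
  shows "ae_class M f = ae_class M g"
proof -
  have "(AE x in M. h x = f x) \<longleftrightarrow> (AE x in M. h x = g x)" for h
    using assms by (auto elim: AE_mp)
  then show ?thesis by (simp add: ae_class_def)
qed

lemma ae_class_eq_iff:
  assumes "f \<in> borel_measurable M"
  shows "ae_class M f = ae_class M g \<longleftrightarrow> (AE x in M. f x = g x)"
  using assms ae_class_eqI[of f g M] by (auto simp: ae_class_def)

lemma ae_rep_ae_class:
  assumes "f \<in> borel_measurable M"
  shows "ae_rep (ae_class M f) \<in> borel_measurable M"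
    and "AE x in M. ae_rep (ae_class M f) x = f x"
proof -
  have "f \<in> ae_class M f" using assms by (simp add: ae_class_def)
  then have "ae_rep (ae_class M f) \<in> ae_class M f" unfolding ae_rep_def
    by (rule someI[where P = "\<lambda>g. g \<in> ae_class M f"])
  then show "ae_rep (ae_class M f) \<in> borel_measurable M"
    and "AE x in M. ae_rep (ae_class M f) x = f x"
    by (simp_all add: ae_class_def)
qed

lemma ae_add_ae_class:
  assumes "f \<in> borel_measurable M" "g \<in> borel_measurable M"
  shows "ae_add M (ae_class M f) (ae_class M g) = ae_class M (\<lambda>x. f x + g x)"
  unfolding ae_add_def using ae_rep_ae_class(2)[OF assms(1)] ae_rep_ae_class(2)[OF assms(2)]
  by (intro ae_class_eqI) auto

lemma ae_diff_ae_class: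
  assumes "f \<in> borel_measurable M" "g \<in> borel_measurable M"
  shows "ae_diff M (ae_class M f) (ae_class M g) = ae_class M (\<lambda>x. f x - g x)"
  unfolding ae_diff_def using ae_rep_ae_class(2)[OF assms(1)] ae_rep_ae_class(2)[OF assms(2)]
  by (intro ae_class_eqI) auto

lemma ae_scale_ae_class:
  assumes "f \<in> borel_measurable M"
  shows "ae_scale M c (ae_class M f) = ae_class M (\<lambda>x. c * f x)"
  unfolding ae_scale_def using ae_rep_ae_class(2)[OF assms]
  by (intro ae_class_eqI) auto

lemma ae_sum_ae_class:
  assumes "finite I" "\<And>i. i \<in> I \<Longrightarrow> f i \<in> borel_measurable M"
  shows "ae_sum M I (\<lambda>i. ae_class M (f i)) = ae_class M (\<lambda>x. \<Sum>i\<in>I. f i x)"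
proof -
  have "AE x in M. \<forall>i\<in>I. ae_rep (ae_class M (f i)) x = f i x"
    using assms(1) ae_rep_ae_class(2)[OF assms(2)] by (simp add: AE_finite_all)
  then show ?thesis unfolding ae_sum_def
    by (intro ae_class_eqI) (auto intro!: sum.cong elim!: AE_mp)
qed

lemma Lp_norm_ae_class:
  assumes "f \<in> borel_measurable M"
  shows "Lp_norm M p (ae_class M f) = Lp_seminorm M p f"
proof -
  let ?r = "ae_rep (ae_class M f)"
  note [measurable] = assms ae_rep_ae_class(1)[OF assms]
  have ae: "AE x in M. ?r x = f x" by (rule ae_rep_ae_class(2)[OF assms])
  have "esssup M (\<lambda>x. ennreal (norm (?r x))) = esssup M (\<lambda>x. ennreal (norm (f x)))"
  proof -
    have "(AE x in M. ennreal (norm (?r x)) \<le> z) \<longleftrightarrow> (AE x in M. ennreal (norm (f x)) \<le> z)" for z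
      using ae by (auto elim: AE_mp)
    then show ?thesis by (simp add: esssup_eq_AE)
  qed
  moreover have "(LINT x|M. norm (?r x) powr enn2real p) = (LINT x|M. norm (f x) powr enn2real p)"
    using ae by (intro integral_cong_AE) auto
  ultimately show ?thesis by (simp add: Lp_norm_def Lp_seminorm_def)
qed

lemma class_expectation_ae_class:
  assumes "f \<in> borel_measurable M"
  shows "class_expectation M (ae_class M f) = (LINT x|M. f x)"
  unfolding class_expectation_def
  using ae_rep_ae_class[OF assms] assms by (intro integral_cong_AE) auto

end

theory Submission
  imports Defs
begin

text \<open>
  Write \<open>P\<^sub>i\<close> for the conditional expectation onto \<open>\<F>\<^sub>i\<close>; in front of a function \<open>E\<close> denotes the
  expectation, otherwise the matrix of the \<open>e\<^sub>i\<^sub>j\<close>.  The coefficient \<open>\<psi>'\<close> enters through one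
  estimate: on \<open>L\<^sup>p\<^sub>0(\<F>\<^sub>j)\<close> the operator \<open>P\<^sub>i\<close> has norm at most \<open>e\<^sub>i\<^sub>j = 1 - \<psi>'(\<F>\<^sub>i, \<F>\<^sub>j)\<close>.  Indeed the
  operator \<open>T s = P\<^sub>i s - \<psi>' E s\<close> on \<open>\<F>\<^sub>j\<close>-measurable functions is positive; this is what
  \<open>\<mu>(A \<inter> B) \<ge> \<psi>' \<mu>(A) \<mu>(B)\<close> says for indicator functions.  Since \<open>T 1 = 1 - \<psi>'\<close> and
  \<open>E (T s) = (1 - \<psi>') E s\<close>, Jensen's inequality gives \<open>\<parallel>T z\<parallel>\<^sub>p \<le> (1 - \<psi>') \<parallel>z\<parallel>\<^sub>p\<close> for every
  exponent, and \<open>T z = P\<^sub>i z\<close> if \<open>z\<close> has mean zero (\<open>conditional_expectation_contraction\<close>).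

  Because \<open>E \<ge> 0\<close> and \<open>r(E) < 1\<close>, there are a strictly positive vector \<open>w\<close> and \<open>\<theta> < 1\<close> with
  \<open>E w \<le> \<theta> w\<close> (\<open>spectral_radius_less_1_imp_weights\<close>).  So on tuples \<open>(z\<^sub>i)\<close> with
  \<open>z\<^sub>i \<in> L\<^sup>p\<^sub>0(\<F>\<^sub>i)\<close> the map \<open>(K z)\<^sub>i = \<Sum>\<^sub>j\<^sub>\<noteq>\<^sub>i P\<^sub>i z\<^sub>j\<close> is a strict contraction for the
  norm \<open>max \<parallel>z\<^sub>i\<parallel>\<^sub>p / w\<^sub>i\<close>, and \<open>I + K\<close> is invertible by a Neumann series.  As
  \<open>P\<^sub>i (\<Sum>\<^sub>j z\<^sub>j) = z\<^sub>i + \<Sum>\<^sub>j\<^sub>\<noteq>\<^sub>i P\<^sub>i z\<^sub>j\<close>, this means that for every \<open>f \<in> L\<^sup>p\<close> the equations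
  \<open>P\<^sub>i S = P\<^sub>i f - E f\<close>, for all \<open>i\<close>, have exactly one solution \<open>S = \<Sum>\<^sub>j z\<^sub>j\<close> in the sum of the
  marginal subspaces, that the summands \<open>z\<^sub>j\<close> are unique as well, and that \<open>\<parallel>S\<parallel>\<^sub>p \<le> C \<parallel>f\<parallel>\<^sub>p\<close>
  (\<open>marginals_zero_if_sum_annihilated\<close>, \<open>marginal_decomposition_exists\<close>).  Uniqueness of the summands
  is linear independence.  Uniqueness of \<open>S\<close> makes \<open>f \<mapsto> S\<close> linear; it fixes the sum
  pointwise and is bounded, so it is the required projection.

  Convergence of the Neumann series is obtained almost everywhere, from summability in \<open>L\<^sup>1\<close>, and
  the \<open>L\<^sup>p\<close> bound then follows from Fatou's lemma.
\<close>

section \<open>Norm bounds in \<open>L\<^sup>p\<close>\<close>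

lemma powr_tangent_le:
  fixes q r t :: real
  assumes "1 \<le> q" "0 < r" "0 \<le> t"
  shows "r powr q + q * r powr (q - 1) * (t - r) \<le> t powr q"
proof (cases "t = 0")
  case True
  have "r powr q + q * r powr (q - 1) * (t - r) = (1 - q) * r powr q"
    using True assms powr_mult_base[of r "q - 1"] by (simp add: algebra_simps)
  then show ?thesis using assms True by (simp add: mult_nonpos_nonneg)
next
  case False
  then have t: "0 < t" using assms by simp
  have "q * r powr (q - 1) * (t - r) \<le> t powr q - r powr q"
  proof (rule convex_on_imp_above_tangent[where A = "{0<..}" and c = r and f = "\<lambda>x. x powr q"])
    show "convex_on {0<..} (\<lambda>x. x powr q)" by (rule powr_convex) fact
    show "((\<lambda>x. x powr q) has_field_derivative q * r powr (q - 1)) (at r within {0<..})"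
      using assms by (auto intro!: derivative_eq_intros)
  qed (use assms t in \<open>auto simp: interior_open\<close>)
  then show ?thesis by simp
qed

text \<open>
  Membership and norm bound are carried together, because the seminorm of a function outside
  \<open>L\<^sup>p\<close> is a meaningless default value.  All estimates below are statements of this form; for a given
  exponent it unfolds to a bound on the \<open>p\<close>-th moment or to an almost sure bound.
\<close>

definition Lp_le :: "'a measure \<Rightarrow> ennreal \<Rightarrow> real \<Rightarrow>
    ('a \<Rightarrow> 'k::{banach, second_countable_topology}) \<Rightarrow> bool" where
  "Lp_le M p C f \<longleftrightarrow> f \<in> Lp_functions M p \<and> Lp_seminorm M p f \<le> C"

text \<open>
  By monotone convergence the sum of the norms has a finite integral, hence is finite almost
  everywhere.
\<close>

lemma AE_summable_norm:
  fixes u :: "nat \<Rightarrow> 'a \<Rightarrow> 'k::{banach, second_countable_topology}"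
  assumes u: "\<And>m. integrable M (u m)" and sm: "summable (\<lambda>m. LINT x|M. norm (u m x))"
  shows "AE x in M. summable (\<lambda>m. norm (u m x))"
proof -
  have [measurable]: "u m \<in> borel_measurable M" for m using u by simp
  have "(\<integral>\<^sup>+x. (\<Sum>m. ennreal (norm (u m x))) \<partial>M) = (\<Sum>m. \<integral>\<^sup>+x. ennreal (norm (u m x)) \<partial>M)"
    by (rule nn_integral_suminf) measurable
  also have "\<dots> = (\<Sum>m. ennreal (LINT x|M. norm (u m x)))"
    using u by (simp add: nn_integral_eq_integral)
  also have "\<dots> = ennreal (\<Sum>m. LINT x|M. norm (u m x))"
    by (rule suminf_ennreal2) (use sm in \<open>auto simp: integral_nonneg_AE\<close>)
  finally have "(\<integral>\<^sup>+x. (\<Sum>m. ennreal (norm (u m x))) \<partial>M) \<noteq> \<infinity>" by simp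
  then have "AE x in M. (\<Sum>m. ennreal (norm (u m x))) \<noteq> \<infinity>"
    by (intro nn_integral_PInf_AE) measurable
  then show ?thesis
    by eventually_elim (rule summable_suminf_not_top, auto)
qed

locale Lp_prob = prob_space M for M :: "'a measure" +
  fixes p :: ennreal
  assumes p_ge_1: "1 \<le> p"
begin

lemma exponent_ge_1: "p \<noteq> \<infinity> \<Longrightarrow> 1 \<le> enn2real p"
  using p_ge_1 by (cases p) auto

lemma Lp_seminorm_nonneg: "0 \<le> Lp_seminorm M p f"
  by (simp add: Lp_seminorm_def)

lemma Lp_leD_measurable: "Lp_le M p C f \<Longrightarrow> f \<in> borel_measurable M"
  by (simp add: Lp_le_def Lp_functions_def)

lemma Lp_le_finite_iff:
  fixes f :: "'a \<Rightarrow> 'k::{banach, second_countable_topology}"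
  assumes "p \<noteq> \<infinity>" "0 \<le> C"
  shows "Lp_le M p C f \<longleftrightarrow> f \<in> borel_measurable M \<and>
    integrable M (\<lambda>x. norm (f x) powr enn2real p) \<and>
    (LINT x|M. norm (f x) powr enn2real p) \<le> C powr enn2real p"
proof -
  let ?I = "LINT x|M. norm (f x) powr enn2real p"
  have q: "1 \<le> enn2real p" by (rule exponent_ge_1) fact
  have I: "0 \<le> ?I" by (intro integral_nonneg_AE) auto
  have "?I powr (1 / enn2real p) \<le> C \<longleftrightarrow> ?I \<le> C powr enn2real p"
  proof
    assume "?I powr (1 / enn2real p) \<le> C"
    then have "(?I powr (1 / enn2real p)) powr enn2real p \<le> C powr enn2real p"
      using q by (intro powr_mono2) auto
    then show "?I \<le> C powr enn2real p" using q I by (simp add: powr_powr)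
  next
    assume "?I \<le> C powr enn2real p"
    then have "?I powr (1 / enn2real p) \<le> (C powr enn2real p) powr (1 / enn2real p)"
      using q I by (intro powr_mono2) auto
    then show "?I powr (1 / enn2real p) \<le> C" using q assms by (simp add: powr_powr)
  qed
  then show ?thesis using assms by (auto simp: Lp_le_def Lp_functions_def Lp_seminorm_def)
qed

lemma Lp_le_infinite_iff:
  fixes f :: "'a \<Rightarrow> 'k::{banach, second_countable_topology}"
  assumes p: "p = \<infinity>" and C: "0 \<le> C"
  shows "Lp_le M p C f \<longleftrightarrow> f \<in> borel_measurable M \<and> (AE x in M. norm (f x) \<le> C)"
proof
  assume L: "Lp_le M p C f"
  then have fin: "esssup M (\<lambda>x. ennreal (norm (f x))) < \<infinity>"
    and le: "enn2real (esssup M (\<lambda>x. ennreal (norm (f x)))) \<le> C"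
    using p by (auto simp: Lp_le_def Lp_functions_def Lp_seminorm_def)
  then have "esssup M (\<lambda>x. ennreal (norm (f x))) \<le> ennreal C"
    by (metis ennreal_enn2real ennreal_leI infinity_ennreal_def)
  moreover have "AE x in M. ennreal (norm (f x)) \<le> esssup M (\<lambda>x. ennreal (norm (f x)))"
    by (rule esssup_AE)
  ultimately have "AE x in M. ennreal (norm (f x)) \<le> ennreal C" by (auto elim: order_trans)
  then show "f \<in> borel_measurable M \<and> (AE x in M. norm (f x) \<le> C)"
    using C Lp_leD_measurable[OF L] by (simp add: ennreal_le_iff)
next
  assume R: "f \<in> borel_measurable M \<and> (AE x in M. norm (f x) \<le> C)"
  then have "esssup M (\<lambda>x. ennreal (norm (f x))) \<le> ennreal C"
    by (intro esssup_I) (auto simp: ennreal_leI)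
  moreover from this have "esssup M (\<lambda>x. ennreal (norm (f x))) < \<infinity>"
    by (rule order_le_less_trans) simp
  moreover from calculation have "enn2real (esssup M (\<lambda>x. ennreal (norm (f x)))) \<le> C"
    using C by (simp add: enn2real_leI)
  ultimately show "Lp_le M p C f" using R p by (auto simp: Lp_le_def Lp_functions_def Lp_seminorm_def)
qed

lemma Lp_le_self: "f \<in> Lp_functions M p \<Longrightarrow> Lp_le M p (Lp_seminorm M p f) f"
  by (simp add: Lp_le_def)

lemma Lp_le_nonneg: "Lp_le M p C f \<Longrightarrow> 0 \<le> C"
  using Lp_seminorm_nonneg order_trans by (auto simp: Lp_le_def)

lemma Lp_le_weaken: "Lp_le M p C f \<Longrightarrow> C \<le> D \<Longrightarrow> Lp_le M p D f"
  by (auto simp: Lp_le_def)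

lemma Lp_le_dominated:
  fixes f :: "'a \<Rightarrow> 'k::{banach, second_countable_topology}"
    and g :: "'a \<Rightarrow> 'l::{banach, second_countable_topology}"
  assumes g: "Lp_le M p C g" and [measurable]: "f \<in> borel_measurable M"
    and le: "AE x in M. norm (f x) \<le> norm (g x)"
  shows "Lp_le M p C f"
proof (cases "p = \<infinity>")
  case True
  have "AE x in M. norm (g x) \<le> C" using g Lp_le_infinite_iff[OF True Lp_le_nonneg[OF g]] by blast
  with le have "AE x in M. norm (f x) \<le> C" by eventually_elim simp
  then show ?thesis using Lp_le_infinite_iff[OF True Lp_le_nonneg[OF g]] assms(2) by blast
next
  case False
  note iff = Lp_le_finite_iff[OF False Lp_le_nonneg[OF g]]
  have q: "1 \<le> enn2real p" by (rule exponent_ge_1) fact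
  have int: "integrable M (\<lambda>x. norm (g x) powr enn2real p)" using g iff by blast
  have le': "AE x in M. norm (f x) powr enn2real p \<le> norm (g x) powr enn2real p"
    using le by eventually_elim (use q in \<open>simp add: powr_mono2\<close>)
  have int': "integrable M (\<lambda>x. norm (f x) powr enn2real p)"
    by (rule Bochner_Integration.integrable_bound[OF int]) (use le' in auto)
  have "(LINT x|M. norm (f x) powr enn2real p) \<le> (LINT x|M. norm (g x) powr enn2real p)"
    by (rule integral_mono_AE) fact+
  then show ?thesis using int' g iff[of g] iff[of f] assms(2) by auto
qed

lemma Lp_le_cong:
  fixes f g :: "'a \<Rightarrow> 'k::{banach, second_countable_topology}"
  assumes "Lp_le M p C g" "f \<in> borel_measurable M" "AE x in M. f x = g x"
  shows "Lp_le M p C f"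
proof (rule Lp_le_dominated[OF assms(1,2)])
  show "AE x in M. norm (f x) \<le> norm (g x)" using assms(3) by eventually_elim simp
qed

lemma Lp_le_zero_iff:
  fixes f :: "'a \<Rightarrow> 'k::{banach, second_countable_topology}"
  assumes [measurable]: "f \<in> borel_measurable M"
  shows "Lp_le M p 0 f \<longleftrightarrow> (AE x in M. f x = 0)"
proof (cases "p = \<infinity>")
  case False
  have q: "1 \<le> enn2real p" by (rule exponent_ge_1) fact
  show ?thesis
  proof
    assume "Lp_le M p 0 f"
    then have int: "integrable M (\<lambda>x. norm (f x) powr enn2real p)"
      and "(LINT x|M. norm (f x) powr enn2real p) \<le> 0"
      using q by (auto simp: Lp_le_finite_iff[OF False])
    moreover have "(LINT x|M. norm (f x) powr enn2real p) \<ge> 0" by (intro integral_nonneg_AE) auto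
    ultimately have "(LINT x|M. norm (f x) powr enn2real p) = 0" by simp
    with int have "AE x in M. norm (f x) powr enn2real p = 0"
      by (subst (asm) integral_nonneg_eq_0_iff_AE) auto
    then show "AE x in M. f x = 0" by simp
  next
    assume ae: "AE x in M. f x = 0"
    then have ae': "AE x in M. norm (f x) powr enn2real p = 0" by simp
    have "integrable M (\<lambda>x. norm (f x) powr enn2real p) \<longleftrightarrow> integrable M (\<lambda>x. 0 :: real)"
      by (rule integrable_cong_AE) (use ae' in auto)
    moreover have "(LINT x|M. norm (f x) powr enn2real p) = (LINT x|M. 0)"
      by (rule integral_cong_AE) (use ae' in auto)
    ultimately show "Lp_le M p 0 f" using q by (simp add: Lp_le_finite_iff[OF False])
  qed
next
  case True
  show ?thesis by (simp add: Lp_le_infinite_iff[OF True])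
qed

lemma Lp_le_const: "Lp_le M p (norm c) (\<lambda>x. c :: 'k::{banach, second_countable_topology})"
proof (cases "p = \<infinity>")
  case True
  show ?thesis by (simp add: Lp_le_infinite_iff[OF True])
next
  case False
  show ?thesis by (simp add: Lp_le_finite_iff[OF False] prob_space)
qed

lemma Lp_le_scale:
  fixes f :: "'a \<Rightarrow> 'k::{banach, second_countable_topology, real_normed_field}"
  assumes "Lp_le M p C f"
  shows "Lp_le M p (norm c * C) (\<lambda>x. c * f x)"
proof (cases "p = \<infinity>")
  case True
  have C: "0 \<le> C" by (rule Lp_le_nonneg) fact
  have "AE x in M. norm (f x) \<le> C" using assms Lp_le_infinite_iff[OF True C] by blast
  then have "AE x in M. norm (c * f x) \<le> norm c * C"
    by eventually_elim (simp add: norm_mult mult_left_mono)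
  then show ?thesis using Lp_leD_measurable[OF assms] C by (simp add: Lp_le_infinite_iff[OF True])
next
  case False
  have C: "0 \<le> C" by (rule Lp_le_nonneg) fact
  then show ?thesis using assms False
    by (auto simp: Lp_le_finite_iff norm_mult powr_mult intro!: mult_left_mono)
qed

lemma Lp_le_minus:
  fixes f :: "'a \<Rightarrow> 'k::{banach, second_countable_topology}"
  assumes "Lp_le M p C f"
  shows "Lp_le M p C (\<lambda>x. - f x)"
  using assms Lp_leD_measurable[OF assms] by (intro Lp_le_dominated[OF assms]) auto

lemma Lp_le_add:
  fixes f g :: "'a \<Rightarrow> 'k::{banach, second_countable_topology}"
  assumes f: "Lp_le M p a f" and g: "Lp_le M p b g"
  shows "Lp_le M p (a + b) (\<lambda>x. f x + g x)"
proof -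
  have ab: "0 \<le> a" "0 \<le> b" using f g by (auto intro: Lp_le_nonneg)
  have [measurable]: "f \<in> borel_measurable M" "g \<in> borel_measurable M"
    using f g by (auto intro: Lp_leD_measurable)
  consider "p = \<infinity>" | "p \<noteq> \<infinity>" "a = 0" | "p \<noteq> \<infinity>" "b = 0" | "p \<noteq> \<infinity>" "0 < a" "0 < b" using ab by linarith
  then show ?thesis
  proof cases
    case 1
    have "AE x in M. norm (f x) \<le> a" "AE x in M. norm (g x) \<le> b"
      using f g Lp_le_infinite_iff[OF 1] ab by blast+
    then have "AE x in M. norm (f x + g x) \<le> a + b"
      by eventually_elim (meson add_mono norm_triangle_le)
    then show ?thesis using ab by (simp add: Lp_le_infinite_iff[OF 1])
  next
    case 2
    with f have "AE x in M. f x = 0" by (simp add: Lp_le_zero_iff)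
    then have "AE x in M. f x + g x = g x" by simp
    then have "Lp_le M p b (\<lambda>x. f x + g x)" by (intro Lp_le_cong[OF g]) simp_all
    then show ?thesis using 2 by simp
  next
    case 3
    with g have "AE x in M. g x = 0" by (simp add: Lp_le_zero_iff)
    then have "AE x in M. f x + g x = f x" by simp
    then have "Lp_le M p a (\<lambda>x. f x + g x)" by (intro Lp_le_cong[OF f]) simp_all
    then show ?thesis using 3 by simp
  next
    case 4
    define q where "q = enn2real p"
    have q: "1 \<le> q" unfolding q_def by (rule exponent_ge_1) fact
    note iff = Lp_le_finite_iff[OF 4(1), folded q_def]
    (* Minkowski from convexity: (|f| + |g|) / (a + b) is a convex combination of |f| / a and |g| / b *)
    let ?D = "\<lambda>x. (a + b) powr q * (a / (a + b) * (norm (f x) powr q / a powr q)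
                 + b / (a + b) * (norm (g x) powr q / b powr q))"
    have pt: "norm (f x + g x) powr q \<le> ?D x" for x
    proof -
      define r where "r = a / (a + b) * (norm (f x) / a) + b / (a + b) * (norm (g x) / b)"
      have r: "norm (f x) + norm (g x) = (a + b) * r" using 4 unfolding r_def
        by (simp add: divide_simps)
      have r0: "0 \<le> r" using 4 by (simp add: r_def)
      have "r powr q \<le> a / (a + b) * (norm (f x) / a) powr q + b / (a + b) * (norm (g x) / b) powr q"
      proof (cases "r = 0")
        case True
        then show ?thesis using 4 by auto
      next
        case False
        then have rp: "0 < r" using r0 by simp
        let ?L = "\<lambda>t. r powr q + q * r powr (q - 1) * (t - r)"
        have s1: "a / (a + b) + b / (a + b) = 1" using 4 by (simp add: divide_simps)
        (* the tangent line ?L at r is affine, so it takes the value r^q at the convex combination r *)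
        have aff: "u * ?L s + v * ?L t = r powr q" if "u * s + v * t = r" "u + v = 1" for u v s t
        proof -
          have "u * ?L s + v * ?L t = (u + v) * (r powr q - q * r powr (q - 1) * r)
              + q * r powr (q - 1) * (u * s + v * t)"
            by (simp add: algebra_simps)
          then show ?thesis using that by simp
        qed
        have "r powr q = a / (a + b) * ?L (norm (f x) / a) + b / (a + b) * ?L (norm (g x) / b)"
          by (rule aff[symmetric]) (use s1 r_def in auto)
        also have "\<dots> \<le> a / (a + b) * (norm (f x) / a) powr q + b / (a + b) * (norm (g x) / b) powr q"
          using 4 q rp by (intro add_mono mult_left_mono powr_tangent_le) auto
        finally show ?thesis .
      qed
      then have "((a + b) * r) powr q \<le> ?D x"
        using 4 r0 by (simp add: powr_mult powr_divide)
      moreover have "norm (f x + g x) powr q \<le> ((a + b) * r) powr q"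
        using q norm_triangle_ineq[of "f x" "g x"] r by (intro powr_mono2) auto
      ultimately show ?thesis by linarith
    qed
    have If: "integrable M (\<lambda>x. norm (f x) powr q)" "(LINT x|M. norm (f x) powr q) \<le> a powr q"
      using f iff[OF ab(1)] by auto
    have Ig: "integrable M (\<lambda>x. norm (g x) powr q)" "(LINT x|M. norm (g x) powr q) \<le> b powr q"
      using g iff[OF ab(2)] by auto
    have ID: "integrable M ?D" using If(1) Ig(1) by simp
    have Ifg: "integrable M (\<lambda>x. norm (f x + g x) powr q)"
      by (rule Bochner_Integration.integrable_bound[OF ID]) (use order_trans[OF pt abs_ge_self] in \<open>auto intro!: AE_I2\<close>)
    have "(LINT x|M. norm (f x + g x) powr q) \<le> (LINT x|M. ?D x)"
      by (rule integral_mono[OF Ifg ID]) (rule pt)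
    also have "\<dots> = (a + b) powr q * (a / (a + b) * ((LINT x|M. norm (f x) powr q) / a powr q)
                 + b / (a + b) * ((LINT x|M. norm (g x) powr q) / b powr q))"
      using If(1) Ig(1) by simp
    also have "\<dots> \<le> (a + b) powr q * (a / (a + b) * 1 + b / (a + b) * 1)"
      using 4 If(2) Ig(2) by (intro mult_left_mono add_mono) (auto simp: divide_le_eq_1)
    also have "\<dots> = (a + b) powr q"
    proof -
      have "a / (a + b) * 1 + b / (a + b) * 1 = 1" using 4 by (simp add: divide_simps)
      then show ?thesis by simp
    qed
    finally show ?thesis using Ifg ab by (simp add: iff)
  qed
qed

lemma Lp_le_diff:
  fixes f g :: "'a \<Rightarrow> 'k::{banach, second_countable_topology}"
  assumes "Lp_le M p a f" "Lp_le M p b g"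
  shows "Lp_le M p (a + b) (\<lambda>x. f x - g x)"
  using Lp_le_add[OF assms(1) Lp_le_minus[OF assms(2)]] by simp

lemma Lp_le_sum:
  fixes f :: "'i \<Rightarrow> 'a \<Rightarrow> 'k::{banach, second_countable_topology}"
  assumes "finite I" "\<And>i. i \<in> I \<Longrightarrow> Lp_le M p (a i) (f i)"
  shows "Lp_le M p (\<Sum>i\<in>I. a i) (\<lambda>x. \<Sum>i\<in>I. f i x)"
  using assms by (induction I rule: finite_induct) (auto intro!: Lp_le_add simp: Lp_le_zero_iff)

text \<open>
  On a probability space the \<open>L\<^sup>1\<close> norm is at most the \<open>L\<^sup>p\<close> norm; for finite \<open>p\<close> this is Jensen's
  inequality for a single tangent line of \<open>t\<^sup>p\<close>.
\<close>

lemma Lp_le_integrable: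
  fixes f :: "'a \<Rightarrow> 'k::{banach, second_countable_topology}"
  assumes f: "Lp_le M p C f"
  shows "integrable M f" and "(LINT x|M. norm (f x)) \<le> C"
proof -
  have C: "0 \<le> C" by (rule Lp_le_nonneg) fact
  have [measurable]: "f \<in> borel_measurable M" by (rule Lp_leD_measurable) fact
  have "\<exists>D. integrable M D \<and> (LINT x|M. D x) \<le> C \<and> (AE x in M. norm (f x) \<le> D x)"
  proof -
    consider "p = \<infinity>" | "p \<noteq> \<infinity>" "C = 0" | "p \<noteq> \<infinity>" "0 < C" using C by linarith
    then show ?thesis
    proof cases
      case 1
      then show ?thesis using f Lp_le_infinite_iff[OF 1 C] by (intro exI[of _ "\<lambda>_. C"]) (auto simp: prob_space)
    next
      case 2
      then have "AE x in M. f x = 0" using f by (simp add: Lp_le_zero_iff)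
      then show ?thesis using C by (intro exI[of _ "\<lambda>_. 0"]) auto
    next
      case 3
      define q where "q = enn2real p"
      have q: "1 \<le> q" unfolding q_def by (rule exponent_ge_1) fact
      have If: "integrable M (\<lambda>x. norm (f x) powr q)" "(LINT x|M. norm (f x) powr q) \<le> C powr q"
        using f Lp_le_finite_iff[OF 3(1) C] by (auto simp: q_def)
      (* the tangent to t^q at t = C, solved for t *)
      define D where "D x = C + (norm (f x) powr q - C powr q) / (q * C powr (q - 1))" for x
      have "norm (f x) \<le> D x" for x
        using powr_tangent_le[OF q 3(2), of "norm (f x)"] q 3(2)
        by (simp add: D_def field_simps)
      moreover have "integrable M D" unfolding D_def using If(1) by simp
      moreover have "(LINT x|M. D x) = C + ((LINT x|M. norm (f x) powr q) - C powr q) / (q * C powr (q - 1))"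
        unfolding D_def using If(1) by (simp add: prob_space)
      moreover have "((LINT x|M. norm (f x) powr q) - C powr q) / (q * C powr (q - 1)) \<le> 0"
        using If(2) q 3(2) by (intro divide_nonpos_pos) auto
      ultimately show ?thesis by (intro exI[of _ D]) auto
    qed
  qed
  then obtain D where D: "integrable M D" "(LINT x|M. D x) \<le> C" "AE x in M. norm (f x) \<le> D x" by blast
  show int: "integrable M f"
  proof (rule Bochner_Integration.integrable_bound[OF D(1)])
    show "AE x in M. norm (f x) \<le> norm (D x)" using D(3) by eventually_elim simp
  qed simp
  have "(LINT x|M. norm (f x)) \<le> (LINT x|M. D x)"
    by (rule integral_mono_AE) (use int D in auto)
  then show "(LINT x|M. norm (f x)) \<le> C" using D(2) by simp
qed

text \<open>
  Fatou's lemma: an \<open>L\<^sup>p\<close> bound survives almost sure limits.  This transfers bounds from partial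
  sums to the limit of the Neumann series.
\<close>

lemma Lp_le_limit:
  fixes f :: "'a \<Rightarrow> 'k::{banach, second_countable_topology}"
  assumes u: "\<And>n. Lp_le M p C (u n)" and [measurable]: "f \<in> borel_measurable M"
    and lim: "AE x in M. (\<lambda>n. u n x) \<longlonglongrightarrow> f x"
  shows "Lp_le M p C f"
proof -
  have C: "0 \<le> C" using Lp_le_nonneg u by blast
  have [measurable]: "u n \<in> borel_measurable M" for n using Lp_leD_measurable u by blast
  show ?thesis
  proof (cases "p = \<infinity>")
    case True
    have "AE x in M. norm (u n x) \<le> C" for n using u Lp_le_infinite_iff[OF True C] by blast
    then have "AE x in M. \<forall>n. norm (u n x) \<le> C" by (simp add: AE_all_countable)
    with lim have "AE x in M. norm (f x) \<le> C"
      by eventually_elim (rule LIMSEQ_le_const2[OF tendsto_norm], auto)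
    then show ?thesis by (simp add: Lp_le_infinite_iff[OF True C])
  next
    case False
    define q where "q = enn2real p"
    have q: "1 \<le> q" unfolding q_def by (rule exponent_ge_1) fact
    note iff = Lp_le_finite_iff[OF False C, folded q_def]
    have un: "(\<integral>\<^sup>+x. ennreal (norm (u n x) powr q) \<partial>M) \<le> ennreal (C powr q)" for n
      using u[of n] by (subst nn_integral_eq_integral) (simp_all add: iff ennreal_leI)
    have "(\<integral>\<^sup>+x. ennreal (norm (f x) powr q) \<partial>M)
        = (\<integral>\<^sup>+x. liminf (\<lambda>n. ennreal (norm (u n x) powr q)) \<partial>M)"
    proof (rule nn_integral_cong_AE)
      show "AE x in M. ennreal (norm (f x) powr q) = liminf (\<lambda>n. ennreal (norm (u n x) powr q))"
        using lim
      proof eventually_elim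
        case (elim x)
        have "(\<lambda>n. ennreal (norm (u n x) powr q)) \<longlonglongrightarrow> ennreal (norm (f x) powr q)"
          using q by (intro tendsto_ennrealI tendsto_powr2 tendsto_norm elim tendsto_const) auto
        then show ?case by (intro lim_imp_Liminf[symmetric]) auto
      qed
    qed
    also have "\<dots> \<le> liminf (\<lambda>n. \<integral>\<^sup>+x. ennreal (norm (u n x) powr q) \<partial>M)"
      by (rule nn_integral_liminf) auto
    also have "\<dots> \<le> ennreal (C powr q)"
      by (rule order_trans[OF Liminf_le_Limsup Limsup_bounded]) (simp_all add: un)
    finally have bd: "(\<integral>\<^sup>+x. ennreal (norm (f x) powr q) \<partial>M) \<le> ennreal (C powr q)" .
    have int: "integrable M (\<lambda>x. norm (f x) powr q)"
    proof (rule integrableI_nonneg)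
      show "(\<integral>\<^sup>+x. ennreal (norm (f x) powr q) \<partial>M) < \<infinity>"
        by (rule order_le_less_trans[OF bd]) simp
    qed simp_all
    then have "ennreal (LINT x|M. norm (f x) powr q) \<le> ennreal (C powr q)"
      using bd by (subst nn_integral_eq_integral[symmetric]) auto
    then show ?thesis using int by (simp add: iff)
  qed
qed

text \<open>
  The \<open>L\<^sup>1\<close> norms are dominated by a geometric series, which gives almost sure convergence;
  the partial sums are bounded in \<open>L\<^sup>p\<close>, which bounds the limit.
\<close>

lemma Lp_le_geometric_series:
  fixes u :: "nat \<Rightarrow> 'a \<Rightarrow> 'k::{banach, second_countable_topology}"
  assumes \<theta>: "0 \<le> \<theta>" "\<theta> < 1" and u: "\<And>m. Lp_le M p (\<theta> ^ m * B) (u m)"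
  shows "summable (\<lambda>m. LINT x|M. norm (u m x))"
    and "AE x in M. summable (\<lambda>m. norm (u m x))"
    and "Lp_le M p (B / (1 - \<theta>)) (\<lambda>x. \<Sum>m. u m x)"
proof -
  have B: "0 \<le> B" using Lp_le_nonneg[OF u[of 0]] by simp
  have ui: "integrable M (u m)" for m by (rule Lp_le_integrable[OF u])
  have [measurable]: "u m \<in> borel_measurable M" for m using ui by simp
  have gs: "summable (\<lambda>m. \<theta> ^ m * B)" using \<theta> by (intro summable_mult2 summable_geometric) simp
  show sm: "summable (\<lambda>m. LINT x|M. norm (u m x))"
    by (rule summable_comparison_test'[OF gs]) (use Lp_le_integrable(2)[OF u] in \<open>simp add: integral_nonneg_AE\<close>)
  show ae: "AE x in M. summable (\<lambda>m. norm (u m x))" by (rule AE_summable_norm[OF ui sm])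
  show "Lp_le M p (B / (1 - \<theta>)) (\<lambda>x. \<Sum>m. u m x)"
  proof (rule Lp_le_limit)
    show "Lp_le M p (B / (1 - \<theta>)) (\<lambda>x. \<Sum>m<N. u m x)" for N
    proof (rule Lp_le_weaken)
      show "Lp_le M p (\<Sum>m<N. \<theta> ^ m * B) (\<lambda>x. \<Sum>m<N. u m x)" by (rule Lp_le_sum) (simp_all only: u finite_lessThan)
      have "(\<Sum>m<N. \<theta> ^ m * B) \<le> (\<Sum>m. \<theta> ^ m * B)"
        using \<theta> B by (intro sum_le_suminf gs) auto
      also have "\<dots> = (\<Sum>m. \<theta> ^ m) * B"
        using \<theta> by (intro suminf_mult2[symmetric] summable_geometric) simp
      also have "\<dots> = B / (1 - \<theta>)" using \<theta> by (simp add: suminf_geometric)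
      finally show "(\<Sum>m<N. \<theta> ^ m * B) \<le> B / (1 - \<theta>)" .
    qed
    show "AE x in M. (\<lambda>N. \<Sum>m<N. u m x) \<longlonglongrightarrow> (\<Sum>m. u m x)"
      using ae by eventually_elim (rule summable_LIMSEQ[OF summable_norm_cancel])
  qed measurable
qed

end

section \<open>Functions with vanishing conditional expectation\<close>

text \<open>
  For integrable \<open>h\<close> this says that the conditional expectation of \<open>h\<close> given \<open>F\<close> vanishes.  That \<open>g\<close> is
  a conditional expectation of \<open>f\<close> becomes: \<open>g\<close> is \<open>F\<close>-measurable and \<open>f - g\<close> is annihilated.  In this form
  linearity needs no almost sure identities between chosen versions, and it makes sense for
  vector-valued functions.
\<close>

definition annihilates :: "'a measure \<Rightarrow> 'a measure \<Rightarrow> ('a \<Rightarrow> 'k::{banach, second_countable_topology}) \<Rightarrow> bool" where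
  "annihilates M F h \<longleftrightarrow> integrable M h \<and> (\<forall>A\<in>sets F. (LINT x:A|M. h x) = 0)"

lemma annihilates_integrable: "annihilates M F h \<Longrightarrow> integrable M h"
  by (simp add: annihilates_def)

lemma integrable_imp_set_integrable:
  fixes h :: "'a \<Rightarrow> 'k::{banach, second_countable_topology}"
  assumes "subalgebra M F" "integrable M h" "A \<in> sets F"
  shows "set_integrable M A h"
  unfolding set_integrable_def using assms by (intro integrable_mult_indicator) (auto simp: subalgebra_def)

lemma annihilates_add:
  fixes g h :: "'a \<Rightarrow> 'k::{banach, second_countable_topology}"
  assumes "subalgebra M F" "annihilates M F g" "annihilates M F h"
  shows "annihilates M F (\<lambda>x. g x + h x)"
proof -
  have i: "integrable M g" "integrable M h" using assms by (auto intro: annihilates_integrable)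
  have "(LINT x:A|M. g x + h x) = 0" if A: "A \<in> sets F" for A
    using assms(2,3) A set_integral_add(2)[OF i[THEN integrable_imp_set_integrable[OF assms(1) _ A]]]
    by (simp add: annihilates_def)
  then show ?thesis using i by (simp add: annihilates_def)
qed

lemma annihilates_bounded_linear:
  fixes T :: "'k::{banach, second_countable_topology} \<Rightarrow> 'l::{banach, second_countable_topology}"
  assumes "subalgebra M F" "bounded_linear T" "annihilates M F h"
  shows "annihilates M F (\<lambda>x. T (h x))"
proof -
  have h: "integrable M h" by (rule annihilates_integrable) fact
  have "(LINT x:A|M. T (h x)) = 0" if A: "A \<in> sets F" for A
  proof -
    have "(LINT x:A|M. T (h x)) = (LINT x|M. T (indicator A x *\<^sub>R h x))"
      unfolding set_lebesgue_integral_def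
      by (simp add: linear_scale[OF bounded_linear.linear[OF assms(2)]])
    also have "\<dots> = T (LINT x:A|M. h x)" unfolding set_lebesgue_integral_def
      using integrable_imp_set_integrable[OF assms(1) h A]
      by (intro integral_bounded_linear assms(2)) (simp add: set_integrable_def)
    finally show ?thesis using assms A
      by (simp add: annihilates_def linear_0[OF bounded_linear.linear[OF assms(2)]])
  qed
  then show ?thesis using integrable_bounded_linear[OF assms(2) h] by (simp add: annihilates_def)
qed

lemma annihilates_minus:
  fixes h :: "'a \<Rightarrow> 'k::{banach, second_countable_topology}"
  assumes "subalgebra M F" "annihilates M F h"
  shows "annihilates M F (\<lambda>x. - h x)"
  by (rule annihilates_bounded_linear[OF assms(1) _ assms(2)]) (rule bounded_linear_minus[OF bounded_linear_ident])

lemma annihilates_diff: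
  fixes g h :: "'a \<Rightarrow> 'k::{banach, second_countable_topology}"
  assumes "subalgebra M F" "annihilates M F g" "annihilates M F h"
  shows "annihilates M F (\<lambda>x. g x - h x)"
  using annihilates_add[OF assms(1,2) annihilates_minus[OF assms(1,3)]] by simp

lemma annihilates_zero: "annihilates M F (\<lambda>x. 0)"
  by (simp add: annihilates_def)

lemma annihilates_sum:
  fixes h :: "'i \<Rightarrow> 'a \<Rightarrow> 'k::{banach, second_countable_topology}"
  assumes "subalgebra M F" "finite I" "\<And>i. i \<in> I \<Longrightarrow> annihilates M F (h i)"
  shows "annihilates M F (\<lambda>x. \<Sum>i\<in>I. h i x)"
  using assms(2,3)
  by (induction I rule: finite_induct) (auto intro!: annihilates_add assms(1) simp: annihilates_zero)

lemma annihilates_cong: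
  fixes g h :: "'a \<Rightarrow> 'k::{banach, second_countable_topology}"
  assumes "subalgebra M F" "annihilates M F g" "h \<in> borel_measurable M" "AE x in M. h x = g x"
  shows "annihilates M F h"
proof -
  note [measurable] = assms(3)
  have g: "integrable M g" by (rule annihilates_integrable) fact
  have [measurable]: "g \<in> borel_measurable M" using g by simp
  have "integrable M h" using integrable_cong_AE[of h M g] g assms(4) by simp
  moreover have "(LINT x:A|M. h x) = 0" if A: "A \<in> sets F" for A
  proof -
    have [measurable]: "A \<in> sets M" using assms(1) A by (auto simp: subalgebra_def)
    have "(LINT x:A|M. h x) = (LINT x:A|M. g x)"
      unfolding set_lebesgue_integral_def
    proof (rule integral_cong_AE)
      show "AE x in M. indicat_real A x *\<^sub>R h x = indicat_real A x *\<^sub>R g x"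
        using assms(4) by eventually_elim simp
    qed simp_all
    then show ?thesis using assms(2) A by (simp add: annihilates_def)
  qed
  ultimately show ?thesis by (simp add: annihilates_def)
qed

lemma annihilates_integral_zero:
  fixes h :: "'a \<Rightarrow> 'k::{banach, second_countable_topology}"
  assumes "subalgebra M F" "annihilates M F h"
  shows "(LINT x|M. h x) = 0"
proof -
  have "space M \<in> sets F" using assms(1) by (metis sets.top subalgebra_def)
  then have "(LINT x:space M|M. h x) = 0" using assms by (simp add: annihilates_def)
  then show ?thesis using annihilates_integrable[OF assms(2)] by (simp add: set_integral_space)
qed

text \<open>
  Dominated convergence on each set of \<open>F\<close>.
\<close>

lemma annihilates_suminf:
  fixes h :: "nat \<Rightarrow> 'a \<Rightarrow> 'k::{banach, second_countable_topology}"
  assumes sub: "subalgebra M F" and h: "\<And>m. annihilates M F (h m)"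
    and ae: "AE x in M. summable (\<lambda>m. norm (h m x))"
    and sm: "summable (\<lambda>m. LINT x|M. norm (h m x))"
  shows "annihilates M F (\<lambda>x. \<Sum>m. h m x)"
proof -
  have int: "integrable M (h m)" for m using h by (rule annihilates_integrable)
  have "(LINT x:A|M. (\<Sum>m. h m x)) = 0" if A: "A \<in> sets F" for A
  proof -
    let ?k = "\<lambda>m x. indicator A x *\<^sub>R h m x"
    have k: "integrable M (?k m)" for m
      using integrable_imp_set_integrable[OF sub int A] by (simp add: set_integrable_def)
    have le: "norm (?k m x) \<le> norm (h m x)" for m x by (simp add: indicator_def)
    have "(LINT x|M. (\<Sum>m. ?k m x)) = (\<Sum>m. LINT x|M. ?k m x)"
    proof (rule integral_suminf[OF k])
      show "AE x in M. summable (\<lambda>m. norm (?k m x))"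
        using ae by eventually_elim (auto intro: summable_comparison_test' simp: indicator_def)
      show "summable (\<lambda>m. LINT x|M. norm (?k m x))"
      proof (rule summable_comparison_test'[OF sm])
        show "norm (LINT x|M. norm (?k m x)) \<le> (LINT x|M. norm (h m x))" for m
          using integral_mono[OF integrable_norm[OF k] integrable_norm[OF int] le, of m]
          by (simp add: integral_nonneg_AE)
      qed
    qed
    also have "(\<lambda>m. LINT x|M. ?k m x) = (\<lambda>m. 0)"
      using h A by (auto simp: annihilates_def set_lebesgue_integral_def)
    finally have "(LINT x|M. (\<Sum>m. ?k m x)) = 0" by simp
    moreover have "(LINT x:A|M. (\<Sum>m. h m x)) = (LINT x|M. (\<Sum>m. ?k m x))"
      unfolding set_lebesgue_integral_def
      by (intro Bochner_Integration.integral_cong) (auto simp: indicator_def)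
    ultimately show ?thesis by simp
  qed
  then show ?thesis using integrable_suminf[OF int ae sm] by (simp add: annihilates_def)
qed

text \<open>
  Test the hypothesis on the set where \<open>h\<close> is negative, which belongs to \<open>F\<close>.
\<close>

lemma AE_nonneg_of_set_integrals_nonneg:
  fixes h :: "'a \<Rightarrow> real"
  assumes sub: "subalgebra M F" and [measurable]: "h \<in> borel_measurable F" and h: "integrable M h"
    and nn: "\<And>A. A \<in> sets F \<Longrightarrow> 0 \<le> (LINT x:A|M. h x)"
  shows "AE x in M. 0 \<le> h x"
proof -
  define A where "A = {x \<in> space F. h x < 0}"
  have A: "A \<in> sets F" unfolding A_def by measurable
  have sp: "space F = space M" using sub by (simp add: subalgebra_def)
  have int: "integrable M (\<lambda>x. - (indicator A x *\<^sub>R h x))"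
    using integrable_imp_set_integrable[OF sub h A] by (simp add: set_integrable_def)
  have pos: "0 \<le> - (indicator A x *\<^sub>R h x)" for x by (simp add: A_def indicator_def)
  have "(LINT x|M. - (indicator A x *\<^sub>R h x)) \<le> 0"
    using nn[OF A] by (simp add: set_lebesgue_integral_def)
  moreover have "0 \<le> (LINT x|M. - (indicator A x *\<^sub>R h x))"
    by (rule Bochner_Integration.integral_nonneg) (rule pos)
  ultimately have "(LINT x|M. - (indicator A x *\<^sub>R h x)) = 0" by linarith
  then have "AE x in M. - (indicator A x *\<^sub>R h x) = 0"
    using integral_nonneg_eq_0_iff_AE[OF int] pos by auto
  then show ?thesis using AE_space
    by eventually_elim (auto simp: A_def sp indicator_def split: if_splits)
qed

text \<open>
  Uniqueness of conditional expectations.  Each coordinate of \<open>h\<close> and its negative have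
  nonnegative integrals over the sets of \<open>F\<close>.
\<close>

lemma annihilates_measurable_zero:
  fixes h :: "'a \<Rightarrow> 'k::euclidean_space"
  assumes sub: "subalgebra M F" and h: "annihilates M F h" and [measurable]: "h \<in> borel_measurable F"
  shows "AE x in M. h x = 0"
proof -
  have "AE x in M. 0 \<le> h x \<bullet> v" for v
  proof (rule AE_nonneg_of_set_integrals_nonneg[OF sub])
    have *: "annihilates M F (\<lambda>x. h x \<bullet> v)"
      by (rule annihilates_bounded_linear[OF sub bounded_linear_inner_left h])
    then show "integrable M (\<lambda>x. h x \<bullet> v)" by (rule annihilates_integrable)
    show "0 \<le> (LINT x:A|M. h x \<bullet> v)" if "A \<in> sets F" for A
      using * that by (simp add: annihilates_def)
  qed measurable
  note nn = this
  have "AE x in M. h x \<bullet> v = 0" for v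
    using nn[of v] nn[of "- v"] by eventually_elim (simp add: inner_minus_right)
  then have "AE x in M. \<forall>b\<in>Basis. h x \<bullet> b = 0" by (simp add: AE_finite_all)
  then show ?thesis by (simp add: euclidean_all_zero_iff)
qed

text \<open>
  A vector-valued conditional expectation is assembled from those of the coordinates.
\<close>

lemma (in prob_space) conditional_expectation_exists:
  fixes f :: "'a \<Rightarrow> 'k::euclidean_space"
  assumes sub: "subalgebra M F" and f: "integrable M f"
  shows "\<exists>g\<in>borel_measurable F. annihilates M F (\<lambda>x. f x - g x)"
proof -
  interpret finite_measure_subalgebra M F by unfold_locales (rule sub)
  define g where "g x = (\<Sum>b\<in>Basis. real_cond_exp M F (\<lambda>y. f y \<bullet> b) x *\<^sub>R b)" for x
  have "annihilates M F (\<lambda>x. (f x \<bullet> b - real_cond_exp M F (\<lambda>y. f y \<bullet> b) x) *\<^sub>R b)" for b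
  proof (rule annihilates_bounded_linear[OF sub, where T = "\<lambda>t. t *\<^sub>R b"])
    have i: "integrable M (\<lambda>y. f y \<bullet> b)" using f by simp
    have i': "integrable M (real_cond_exp M F (\<lambda>y. f y \<bullet> b))" by (rule real_cond_exp_int) (rule i)
    show "annihilates M F (\<lambda>x. f x \<bullet> b - real_cond_exp M F (\<lambda>y. f y \<bullet> b) x)"
      using i i' integrable_imp_set_integrable[OF sub i] integrable_imp_set_integrable[OF sub i']
      by (auto simp: annihilates_def real_cond_exp_intA[OF i])
  qed (rule bounded_linear_scaleR_left)
  then have "annihilates M F (\<lambda>x. \<Sum>b\<in>Basis. (f x \<bullet> b - real_cond_exp M F (\<lambda>y. f y \<bullet> b) x) *\<^sub>R b)"
    by (intro annihilates_sum[OF sub]) auto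
  moreover have "(\<Sum>b\<in>Basis. (f x \<bullet> b - real_cond_exp M F (\<lambda>y. f y \<bullet> b) x) *\<^sub>R b) = f x - g x" for x
    by (simp add: g_def scaleR_diff_left sum_subtractf euclidean_representation)
  moreover have "g \<in> borel_measurable F" unfolding g_def by measurable
  ultimately show ?thesis by auto
qed

definition cond_expectation ::
    "'a measure \<Rightarrow> 'a measure \<Rightarrow> ('a \<Rightarrow> 'k::euclidean_space) \<Rightarrow> 'a \<Rightarrow> 'k" where
  "cond_expectation M F f = (SOME g. g \<in> borel_measurable F \<and> annihilates M F (\<lambda>x. f x - g x))"

lemma (in prob_space) cond_expectation:
  fixes f :: "'a \<Rightarrow> 'k::euclidean_space"
  assumes F: "subalgebra M F" and f: "integrable M f"
  shows "cond_expectation M F f \<in> borel_measurable F"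
    and "annihilates M F (\<lambda>x. f x - cond_expectation M F f x)"
    and "(LINT x|M. cond_expectation M F f x) = (LINT x|M. f x)"
proof -
  let ?g = "cond_expectation M F f"
  have *: "?g \<in> borel_measurable F \<and> annihilates M F (\<lambda>x. f x - ?g x)"
    unfolding cond_expectation_def
    using conditional_expectation_exists[OF F f] by (intro someI_ex[of "\<lambda>g. g \<in> borel_measurable F \<and> annihilates M F (\<lambda>x. f x - g x)"]) blast
  then show "?g \<in> borel_measurable F" "annihilates M F (\<lambda>x. f x - ?g x)" by auto
  have "integrable M ?g"
    using Bochner_Integration.integrable_diff[OF f annihilates_integrable[OF conjunct2[OF *]]] by simp
  then show "(LINT x|M. ?g x) = (LINT x|M. f x)"
    using annihilates_integral_zero[OF F conjunct2[OF *]] f by simp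
qed

section \<open>Contraction of conditional expectations under a mixing bound\<close>

text \<open>
  A family of inequalities that depends continuously on its parameter holds simultaneously for all
  parameters off one null set, since countably many parameters decide.  Jensen's inequality is
  derived in this way from its affine minorants.
\<close>

lemma AE_all_of_countable_dense:
  fixes f :: "'b::second_countable_topology \<Rightarrow> 'a \<Rightarrow> real"
  assumes ae: "\<And>w. AE x in M. 0 \<le> f w x" and cont: "\<And>x. continuous_on UNIV (\<lambda>w. f w x)"
  shows "AE x in M. \<forall>w. 0 \<le> f w x"
proof -
  obtain D :: "'b set" where D: "countable D" "\<And>X. open X \<Longrightarrow> X \<noteq> {} \<Longrightarrow> \<exists>d\<in>D. d \<in> X"
    by (rule countable_dense_setE) blast
  have "AE x in M. \<forall>w\<in>D. 0 \<le> f w x" using D(1) ae by (simp add: AE_ball_countable)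
  then show ?thesis
  proof eventually_elim
    case (elim x)
    have "open {w. f w x < 0}" using cont by (intro open_Collect_less) auto
    then have "{w. f w x < 0} = {}" using D(2) elim by fastforce
    then show ?case by (auto simp: not_less)
  qed
qed

context prob_space
begin

text \<open>
  The bound \<open>\<psi>'(F, G) \<ge> c\<close>, without division.  With \<open>c = 0\<close> it holds for all \<open>F\<close> and \<open>G\<close>, so that
  the statements below contain the corresponding facts on ordinary conditional expectations.
\<close>

definition mixing_bound :: "real \<Rightarrow> 'a measure \<Rightarrow> 'a measure \<Rightarrow> bool" where
  "mixing_bound c F G \<longleftrightarrow> 0 \<le> c \<and> c \<le> 1 \<and>
     (\<forall>A\<in>sets F. \<forall>B\<in>sets G. c * (prob A * prob B) \<le> prob (A \<inter> B))"

text \<open>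
  The inequality for indicator functions of sets in \<open>G\<close> compares two measures on \<open>G\<close>, the restriction
  of \<open>\<mu>\<close> to \<open>A\<close> and the multiple \<open>c \<mu>(A)\<close> of \<open>\<mu>\<close>; integration is monotone in the measure.
\<close>

lemma mixing_bound_set_integral:
  fixes s :: "'a \<Rightarrow> real"
  assumes F: "subalgebra M F" and G: "subalgebra M G" and c: "mixing_bound c F G"
    and [measurable]: "s \<in> borel_measurable G" and s: "integrable M s" "AE x in M. 0 \<le> s x"
    and A: "A \<in> sets F"
  shows "c * (LINT x|M. s x) * prob A \<le> (LINT x:A|M. s x)"
proof -
  have [measurable]: "A \<in> sets M" using F A by (auto simp: subalgebra_def)
  have [measurable]: "s \<in> borel_measurable M" using s by simp
  have c0: "0 \<le> c" using c by (simp add: mixing_bound_def)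
  let ?N = "restr_to_subalg (density M (indicator A)) G"
  let ?L = "scale_measure (ennreal (c * prob A)) (restr_to_subalg M G)"
  have G': "subalgebra (density M (indicator A)) G" using G by (simp add: subalgebra_def)
  have sets: "sets ?L = sets ?N" by (simp add: sets_restr_to_subalg[OF G] sets_restr_to_subalg[OF G'])
  have "emeasure ?L B \<le> emeasure ?N B" if "B \<in> sets ?L" for B
  proof -
    have B: "B \<in> sets G" using that by (simp add: sets_restr_to_subalg[OF G])
    then have [measurable]: "B \<in> sets M" using G by (auto simp: subalgebra_def)
    have "emeasure ?L B = ennreal (c * prob A) * emeasure M B"
      using emeasure_restr_to_subalg[OF G B] by simp
    also have "\<dots> = ennreal (c * (prob A * prob B))"
      using c0 by (simp add: emeasure_eq_measure ennreal_mult[symmetric] mult.assoc)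
    also have "\<dots> \<le> ennreal (prob (A \<inter> B))"
      using c A B by (intro ennreal_leI) (auto simp: mixing_bound_def)
    also have "\<dots> = emeasure (density M (indicator A)) B"
      by (simp add: emeasure_density indicator_inter_arith[symmetric] emeasure_eq_measure)
    also have "\<dots> = emeasure ?N B" using emeasure_restr_to_subalg[OF G' B] by simp
    finally show ?thesis .
  qed
  then have "?L \<le> ?N" using le_measure[OF sets] by blast
  then have "(\<integral>\<^sup>+x. ennreal (s x) \<partial>?L) \<le> (\<integral>\<^sup>+x. ennreal (s x) \<partial>?N)"
    by (rule nn_integral_mono_measure[OF sets])
  also have "(\<integral>\<^sup>+x. ennreal (s x) \<partial>?N) = (\<integral>\<^sup>+x. indicator A x * ennreal (s x) \<partial>M)"
    using nn_integral_subalgebra2[OF G'] by (simp add: nn_integral_density)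
  also have "\<dots> = (\<integral>\<^sup>+x. ennreal (indicator A x *\<^sub>R s x) \<partial>M)"
    by (intro nn_integral_cong) (simp add: indicator_def)
  also have "\<dots> = ennreal (LINT x:A|M. s x)"
    unfolding set_lebesgue_integral_def
  proof (rule nn_integral_eq_integral)
    show "integrable M (\<lambda>x. indicator A x *\<^sub>R s x)" using s(1) by (intro integrable_mult_indicator) auto
    show "AE x in M. 0 \<le> indicat_real A x *\<^sub>R s x" using s(2) by eventually_elim simp
  qed
  also have "(\<integral>\<^sup>+x. ennreal (s x) \<partial>?L) = ennreal (c * prob A) * (\<integral>\<^sup>+x. ennreal (s x) \<partial>M)"
  proof -
    have "(\<lambda>x. ennreal (s x)) \<in> borel_measurable (restr_to_subalg M G)"
      by (rule measurable_in_subalg[OF G]) measurable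
    then show ?thesis using nn_integral_subalgebra2[OF G] by (simp add: nn_integral_scale_measure)
  qed
  also have "(\<integral>\<^sup>+x. ennreal (s x) \<partial>M) = ennreal (LINT x|M. s x)"
    by (rule nn_integral_eq_integral) fact+
  finally have "ennreal (c * prob A * (LINT x|M. s x)) \<le> ennreal (LINT x:A|M. s x)"
    using c0 integral_nonneg_AE[OF s(2)] by (simp add: ennreal_mult[symmetric])
  moreover have "0 \<le> (LINT x:A|M. s x)"
    unfolding set_lebesgue_integral_def
  proof (rule integral_nonneg_AE)
    show "AE x in M. 0 \<le> indicat_real A x *\<^sub>R s x" using s(2) by eventually_elim simp
  qed
  ultimately show ?thesis by (simp add: ennreal_le_iff mult_ac)
qed

text \<open>
  Positivity, on \<open>G\<close>-measurable functions, of the operator that subtracts \<open>c\<close> times the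
  expectation from the conditional expectation given \<open>F\<close>.
\<close>

lemma conditional_expectation_lower_bound:
  fixes s h :: "'a \<Rightarrow> real"
  assumes F: "subalgebra M F" and G: "subalgebra M G" and c: "mixing_bound c F G"
    and sG: "s \<in> borel_measurable G" and s: "integrable M s" "AE x in M. 0 \<le> s x"
    and [measurable]: "h \<in> borel_measurable F" and sh: "annihilates M F (\<lambda>x. s x - h x)"
  shows "AE x in M. c * (LINT x|M. s x) \<le> h x"
proof -
  have h: "integrable M h"
    using Bochner_Integration.integrable_diff[OF s(1) annihilates_integrable[OF sh]] by simp
  have "AE x in M. 0 \<le> h x - c * (LINT x|M. s x)"
  proof (rule AE_nonneg_of_set_integrals_nonneg[OF F])
    fix A assume A: "A \<in> sets F"
    have [measurable]: "A \<in> sets M" using F A by (auto simp: subalgebra_def)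
    have "(LINT x:A|M. s x) - (LINT x:A|M. h x) = 0"
      using sh A set_integral_diff(2)[OF integrable_imp_set_integrable[OF F s(1) A]
          integrable_imp_set_integrable[OF F h A]]
      by (simp add: annihilates_def)
    moreover have "(LINT x:A|M. h x - c * (LINT x|M. s x)) = (LINT x:A|M. h x) - prob A * (c * (LINT x|M. s x))"
      using integrable_imp_set_integrable[OF F h A] integrable_imp_set_integrable[OF F _ A, of "\<lambda>_. c * (LINT x|M. s x)"]
      by (subst set_integral_diff) (auto simp: set_lebesgue_integral_def)
    ultimately show "0 \<le> (LINT x:A|M. h x - c * (LINT x|M. s x))"
      using mixing_bound_set_integral[OF F G c sG s A] by (simp add: mult_ac)
  qed (use h in auto)
  then show ?thesis by simp
qed


text \<open>
  Let \<open>T\<close> be the positive operator of the previous lemma.  The claim is \<open>|T z| \<le> T |z|\<close>: apply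
  positivity to \<open>|w| |z| - z \<bullet> w\<close> for each constant vector \<open>w\<close>, and then choose \<open>w = T z\<close> pointwise.
\<close>

lemma conditional_expectation_norm_bound:
  fixes z g :: "'a \<Rightarrow> 'k::euclidean_space" and h :: "'a \<Rightarrow> real"
  assumes F: "subalgebra M F" and G: "subalgebra M G" and c: "mixing_bound c F G"
    and zG: "z \<in> borel_measurable G" and z: "integrable M z"
    and gF: "g \<in> borel_measurable F" and zg: "annihilates M F (\<lambda>x. z x - g x)"
    and hF: "h \<in> borel_measurable F" and zh: "annihilates M F (\<lambda>x. norm (z x) - h x)"
  shows "AE x in M. norm (g x - c *\<^sub>R (LINT x|M. z x)) \<le> h x - c * (LINT x|M. norm (z x))"
proof -
  note [measurable] = zG gF hF
  let ?y = "\<lambda>x. h x - c * (LINT x|M. norm (z x))"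
  let ?v = "\<lambda>x. g x - c *\<^sub>R (LINT x|M. z x)"
  have y: "AE x in M. 0 \<le> ?y x"
    using conditional_expectation_lower_bound[OF F G c _ _ _ hF zh] z by simp
  have "AE x in M. 0 \<le> norm w * ?y x - ?v x \<bullet> w" for w
  proof -
    have "AE x in M. c * (LINT x|M. norm w * norm (z x) - z x \<bullet> w) \<le> norm w * h x - g x \<bullet> w"
    proof (rule conditional_expectation_lower_bound[OF F G c])
      show "integrable M (\<lambda>x. norm w * norm (z x) - z x \<bullet> w)" using z by simp
      show "AE x in M. 0 \<le> norm w * norm (z x) - z x \<bullet> w"
        by (simp add: norm_cauchy_schwarz mult.commute[of "norm w"])
      have "annihilates M F (\<lambda>x. norm w * (norm (z x) - h x) - (z x - g x) \<bullet> w)"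
        by (intro annihilates_diff[OF F] annihilates_bounded_linear[OF F bounded_linear_mult_right zh]
            annihilates_bounded_linear[OF F bounded_linear_inner_left zg])
      then show "annihilates M F (\<lambda>x. norm w * norm (z x) - z x \<bullet> w - (norm w * h x - g x \<bullet> w))"
        by (simp add: algebra_simps inner_diff_left)
    qed measurable
    moreover have "(LINT x|M. norm w * norm (z x) - z x \<bullet> w)
        = norm w * (LINT x|M. norm (z x)) - (LINT x|M. z x) \<bullet> w"
      using z by simp
    ultimately show ?thesis by (simp add: algebra_simps inner_diff_left)
  qed
  then have "AE x in M. \<forall>w. 0 \<le> norm w * ?y x - ?v x \<bullet> w"
    by (rule AE_all_of_countable_dense) (intro continuous_intros)
  then show ?thesis using y
  proof eventually_elim
    case (elim x)
    then have "norm (?v x) * norm (?v x) \<le> norm (?v x) * ?y x"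
      by (metis diff_ge_0_iff_ge power2_eq_square power2_norm_eq_inner)
    then show ?case using elim(2) by (cases "?v x = 0") auto
  qed
qed

end

text \<open>
  The full space shows that the infimum is taken over a nonempty set and is at most one; for null
  sets the inequality is trivial.
\<close>

lemma (in prob_space) mixing_bound_psi':
  assumes F: "subalgebra M F" and G: "subalgebra M G"
  shows "mixing_bound (psi' M F G) F G"
proof -
  let ?S = "{prob (a \<inter> b) / (prob a * prob b) |a b.
     a \<in> sets F \<and> b \<in> sets G \<and> prob a > 0 \<and> prob b > 0}"
  have bdd: "bdd_below ?S" by (rule bdd_belowI[of _ 0]) auto
  have "space M \<in> sets F" "space M \<in> sets G" using F G by (metis sets.top subalgebra_def)+
  then have one: "1 \<in> ?S" by (force simp: prob_space)
  have "0 \<le> psi' M F G" unfolding psi'_def using one by (intro cInf_greatest) auto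
  moreover have "psi' M F G \<le> 1" unfolding psi'_def by (rule cInf_lower[OF one bdd])
  moreover have "psi' M F G * (prob A * prob B) \<le> prob (A \<inter> B)" if A: "A \<in> sets F" and B: "B \<in> sets G" for A B
  proof (cases "prob A > 0 \<and> prob B > 0")
    case True
    then have "psi' M F G \<le> prob (A \<inter> B) / (prob A * prob B)"
      unfolding psi'_def using A B by (intro cInf_lower[OF _ bdd]) auto
    then show ?thesis using True by (simp add: pos_le_divide_eq)
  next
    case False
    then have "prob A = 0 \<or> prob B = 0" by (metis measure_nonneg not_less order_antisym)
    then show ?thesis by auto
  qed
  ultimately show ?thesis by (simp add: mixing_bound_def)
qed

context Lp_prob
begin

text \<open>
  Put \<open>T s = h - c E s\<close> and \<open>d = 1 - c\<close>.  Since \<open>T\<close> is positive and \<open>T 1 = d\<close>, applying \<open>T\<close> to the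
  tangent lines of \<open>t\<^sup>q\<close> gives \<open>(T s)\<^sup>q \<le> d\<^bsup>q-1\<^esup> T (s\<^sup>q)\<close>, and \<open>T (s\<^sup>q)\<close> has integral \<open>d E (s\<^sup>q)\<close>.
  If \<open>d = 0\<close>, the nonnegative function \<open>T s\<close> has integral zero.  For \<open>p = \<infinity>\<close> apply \<open>T\<close> to \<open>C - s\<close>.
\<close>

lemma conditional_expectation_contraction_nonneg:
  fixes s h :: "'a \<Rightarrow> real"
  assumes F: "subalgebra M F" and G: "subalgebra M G" and c: "mixing_bound c F G"
    and sG: "s \<in> borel_measurable G" and s0: "\<And>x. 0 \<le> s x" and s: "Lp_le M p C s"
    and hF: "h \<in> borel_measurable F" and sh: "annihilates M F (\<lambda>x. s x - h x)"
  shows "Lp_le M p ((1 - c) * C) (\<lambda>x. h x - c * (LINT x|M. s x))"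
proof -
  let ?y = "\<lambda>x. h x - c * (LINT x|M. s x)"
  define d where "d = 1 - c"
  have d: "0 \<le> d" using c by (simp add: d_def mixing_bound_def)
  have C: "0 \<le> C" by (rule Lp_le_nonneg[OF s])
  have si: "integrable M s" by (rule Lp_le_integrable[OF s])
  have hi: "integrable M h"
    using Bochner_Integration.integrable_diff[OF si annihilates_integrable[OF sh]] by simp
  have Eh: "(LINT x|M. h x) = (LINT x|M. s x)"
    using annihilates_integral_zero[OF F sh] si hi by simp
  have hM [measurable]: "h \<in> borel_measurable M" using hi by simp
  have y0: "AE x in M. 0 \<le> ?y x"
    using conditional_expectation_lower_bound[OF F G c sG si _ hF sh] s0 by simp
  show ?thesis
  proof (cases "p = \<infinity>")
    case True
    have sC: "AE x in M. s x \<le> C" using s s0 by (simp add: Lp_le_infinite_iff[OF True C])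
    have "AE x in M. c * (LINT x|M. C - s x) \<le> C - h x"
    proof (rule conditional_expectation_lower_bound[OF F G c])
      show "annihilates M F (\<lambda>x. C - s x - (C - h x))"
        using annihilates_minus[OF F sh] by simp
    qed (use sG hF si sC in auto)
    then have "AE x in M. norm (?y x) \<le> (1 - c) * C" using y0
      by eventually_elim (use si in \<open>simp add: prob_space algebra_simps\<close>)
    then show ?thesis using d C by (simp add: Lp_le_infinite_iff[OF True] d_def)
  next
    case False
    define q where "q = enn2real p"
    have q: "1 \<le> q" unfolding q_def by (rule exponent_ge_1) fact
    note iff = Lp_le_finite_iff[OF False, folded q_def]
    have sq: "integrable M (\<lambda>x. s x powr q)" "(LINT x|M. s x powr q) \<le> C powr q"
      using s s0 by (simp_all add: iff[OF C])
    have sqG: "(\<lambda>x. s x powr q) \<in> borel_measurable G" using sG by measurable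
    obtain k where kF: "k \<in> borel_measurable F" and sk: "annihilates M F (\<lambda>x. s x powr q - k x)"
      using conditional_expectation_exists[OF F sq(1)] by blast
    have ki: "integrable M k"
      using Bochner_Integration.integrable_diff[OF sq(1) annihilates_integrable[OF sk]] by simp
    have Ek: "(LINT x|M. k x) = (LINT x|M. s x powr q)"
      using annihilates_integral_zero[OF F sk] sq(1) ki by simp
    let ?Y = "\<lambda>x. k x - c * (LINT x|M. s x powr q)"
    have EY: "(LINT x|M. ?Y x) = d * (LINT x|M. s x powr q)"
      using ki by (simp add: Ek prob_space d_def algebra_simps)
    have Ey: "(LINT x|M. ?y x) = d * (LINT x|M. s x)"
      using hi by (simp add: Eh prob_space d_def algebra_simps)
    have Y0: "AE x in M. 0 \<le> ?Y x"
      using conditional_expectation_lower_bound[OF F G c sqG sq(1) _ kF sk] by simp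
    show ?thesis
    proof (cases "d = 0")
      case True
      have "AE x in M. ?y x = 0"
        using integral_nonneg_eq_0_iff_AE[OF _ y0] hi Ey True by simp
      then show ?thesis using True by (simp add: Lp_le_zero_iff d_def)
    next
      case False
      then have dp: "0 < d" using d by simp
      (* the parametrisation r = exp t of the points of tangency turns "all positive r" into
         "all real t", to which the density argument applies *)
      have "AE x in M. 0 \<le> ?Y x - (d * exp t powr q + q * exp t powr (q - 1) * (?y x - d * exp t))" for t :: real
      proof -
        let ?a = "exp t powr q" and ?b = "q * exp t powr (q - 1)" and ?r = "exp t"
        have "AE x in M. c * (LINT x|M. s x powr q - (?a + ?b * (s x - ?r))) \<le> k x - (?a + ?b * (h x - ?r))"
        proof (rule conditional_expectation_lower_bound[OF F G c])
          show "AE x in M. 0 \<le> s x powr q - (?a + ?b * (s x - ?r))"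
            using powr_tangent_le[OF q, of ?r] s0 by simp
          have "annihilates M F (\<lambda>x. (s x powr q - k x) - ?b * (s x - h x))"
            by (intro annihilates_diff[OF F] sk annihilates_bounded_linear[OF F bounded_linear_mult_right sh])
          then show "annihilates M F (\<lambda>x. s x powr q - (?a + ?b * (s x - ?r)) - (k x - (?a + ?b * (h x - ?r))))"
            by (simp add: algebra_simps)
        qed (use sG sqG hF kF si sq(1) in auto)
        moreover have "(LINT x|M. s x powr q - (?a + ?b * (s x - ?r)))
            = (LINT x|M. s x powr q) - (?a + ?b * ((LINT x|M. s x) - ?r))"
          using si sq(1) by (simp add: prob_space)
        ultimately show ?thesis
          by (simp add: d_def) (simp add: algebra_simps)
      qed
      then have "AE x in M. \<forall>t::real. 0 \<le> ?Y x - (d * exp t powr q + q * exp t powr (q - 1) * (?y x - d * exp t))"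
        by (rule AE_all_of_countable_dense) (intro continuous_intros, auto)
      then have le: "AE x in M. ?y x powr q \<le> d powr (q - 1) * ?Y x" using y0 Y0
      proof eventually_elim
        case (elim x)
        show ?case
        proof (cases "?y x = 0")
          case False
          then have "exp (ln (?y x / d)) = ?y x / d" using elim(2) dp by simp
          then have "0 \<le> ?Y x - (d * (?y x / d) powr q)"
            using elim(1)[rule_format, of "ln (?y x / d)"] dp by simp
          then have "d powr (q - 1) * (d * (?y x / d) powr q) \<le> d powr (q - 1) * ?Y x"
            using dp by (intro mult_left_mono) auto
          moreover have "d powr (q - 1) * d = d powr q"
            using dp powr_mult_base[of d "q - 1"] by (simp add: mult.commute)
          then have "d powr (q - 1) * (d * (?y x / d) powr q) = ?y x powr q"
            using dp elim(2) by (simp add: powr_divide mult.assoc[symmetric])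
          ultimately show ?thesis by simp
        qed (use elim in auto)
      qed
      have int: "integrable M (\<lambda>x. ?y x powr q)"
      proof (rule Bochner_Integration.integrable_bound)
        show "integrable M (\<lambda>x. d powr (q - 1) * ?Y x)" using ki by simp
        show "AE x in M. norm (?y x powr q) \<le> norm (d powr (q - 1) * ?Y x)"
          using le by eventually_elim (metis abs_ge_self abs_of_nonneg order_trans powr_ge_zero real_norm_def)
      qed measurable
      have "(LINT x|M. ?y x powr q) \<le> (LINT x|M. d powr (q - 1) * ?Y x)"
        by (rule integral_mono_AE[OF int _ le]) (use ki in simp)
      also have "\<dots> = d powr (q - 1) * d * (LINT x|M. s x powr q)"
        by (simp only: integral_mult_right_zero EY mult.assoc)
      also have "d powr (q - 1) * d = d powr q"
        using dp powr_mult_base[of d "q - 1"] by (simp add: mult.commute)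
      also have "d powr q * (LINT x|M. s x powr q) \<le> d powr q * C powr q"
        using sq(2) by (intro mult_left_mono) auto
      also have "\<dots> = (d * C) powr q" using d C by (simp add: powr_mult)
      finally have bd: "(LINT x|M. ?y x powr q) \<le> (d * C) powr q" .
      have abs: "AE x in M. norm (?y x) powr q = ?y x powr q" using y0 by eventually_elim simp
      have "integrable M (\<lambda>x. norm (?y x) powr q) = integrable M (\<lambda>x. ?y x powr q)"
        by (rule integrable_cong_AE[OF _ _ abs]) measurable
      moreover have "(LINT x|M. norm (?y x) powr q) = (LINT x|M. ?y x powr q)"
        by (rule integral_cong_AE[OF _ _ abs]) measurable
      ultimately show ?thesis using int bd d C by (simp add: iff d_def)
    qed
  qed
qed

text \<open>
  The estimate that brings in the mixing coefficient.  For \<open>z\<close> of mean zero it says that the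
  conditional expectation given \<open>F\<close> shrinks the \<open>L\<^sup>p\<close> norm at least by the factor \<open>1 - c\<close>.
\<close>

theorem conditional_expectation_contraction:
  fixes z g :: "'a \<Rightarrow> 'k::euclidean_space"
  assumes F: "subalgebra M F" and G: "subalgebra M G" and c: "mixing_bound c F G"
    and zG: "z \<in> borel_measurable G" and z: "Lp_le M p C z"
    and gF: "g \<in> borel_measurable F" and zg: "annihilates M F (\<lambda>x. z x - g x)"
  shows "Lp_le M p ((1 - c) * C) (\<lambda>x. g x - c *\<^sub>R (LINT x|M. z x))"
proof -
  have zi: "integrable M z" by (rule Lp_le_integrable[OF z])
  have n: "(\<lambda>x. norm (z x)) \<in> borel_measurable G" using zG by measurable
  obtain h where hF: "h \<in> borel_measurable F" and zh: "annihilates M F (\<lambda>x. norm (z x) - h x)"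
    using conditional_expectation_exists[OF F integrable_norm[OF zi]] by blast
  have s: "Lp_le M p C (\<lambda>x. norm (z x))" using zi by (intro Lp_le_dominated[OF z]) auto
  have le: "AE x in M. norm (g x - c *\<^sub>R (LINT x|M. z x)) \<le> h x - c * (LINT x|M. norm (z x))"
    by (rule conditional_expectation_norm_bound[OF F G c zG zi gF zg hF zh])
  show ?thesis
  proof (rule Lp_le_dominated)
    show "Lp_le M p ((1 - c) * C) (\<lambda>x. h x - c * (LINT x|M. norm (z x)))"
      by (rule conditional_expectation_contraction_nonneg[OF F G c n _ s hF zh]) simp
    show "AE x in M. norm (g x - c *\<^sub>R (LINT x|M. z x)) \<le> norm (h x - c * (LINT x|M. norm (z x)))"
      using le by eventually_elim (simp add: order_trans[OF _ abs_ge_self])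
    show "(\<lambda>x. g x - c *\<^sub>R (LINT x|M. z x)) \<in> borel_measurable M"
      using measurable_from_subalg[OF F gF] by measurable
  qed
qed

end

section \<open>Nonnegative matrices of spectral radius below one\<close>

lemma spectral_radius_less_1_power_bound:
  fixes B :: "complex mat"
  assumes B: "B \<in> carrier_mat n n" and sr: "spectral_radius B < 1"
  shows "\<exists>K. \<forall>k. norm_bound (B ^\<^sub>m k) K"
proof (rule spectral_radius_jnf_norm_bound_less_1[OF B sr])
  obtain as where "char_poly B = (\<Prod>a\<leftarrow>as. [:- a, 1:])"
    using char_poly_factorized[OF B] by blast
  then show "\<exists>n_as. jordan_nf B n_as" by (rule jordan_nf_exists[OF B])
qed

lemma spectral_radius_scaled_less_1:
  fixes A B :: "complex mat" and r :: real
  assumes B: "B \<in> carrier_mat n n" and n: "0 < n" and A: "A = complex_of_real r \<cdot>\<^sub>m B"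
    and r: "spectral_radius A < r"
  shows "spectral_radius B < 1"
proof -
  have A': "A \<in> carrier_mat n n" using A B by simp
  have "0 \<le> spectral_radius A" using spectral_radius_mem_max(1)[OF A' n] by auto
  then have r0: "0 < r" using r by simp
  obtain a where l: "a \<in> spectrum B" "spectral_radius B = norm a"
    using spectral_radius_mem_max(1)[OF B n] by blast
  then obtain v where v: "v \<in> carrier_vec n" "v \<noteq> 0\<^sub>v n" "B *\<^sub>v v = a \<cdot>\<^sub>v v"
    using B by (auto simp: spectrum_def eigenvalue_def eigenvector_def)
  have "A *\<^sub>v v = (complex_of_real r * a) \<cdot>\<^sub>v v"
  proof -
    have "A *\<^sub>v v = complex_of_real r \<cdot>\<^sub>v (B *\<^sub>v v)"
      using A B v(1) by (intro eq_vecI) auto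
    then show ?thesis by (simp add: v(3) smult_smult_assoc)
  qed
  then have "complex_of_real r * a \<in> spectrum A"
    using v A' by (auto simp: spectrum_def eigenvalue_def eigenvector_def)
  then have "norm (complex_of_real r * a) \<le> spectral_radius A"
    by (intro spectral_radius_mem_max(2)[OF A' n]) auto
  then have "r * norm a \<le> spectral_radius A" using r0 by (simp add: norm_mult)
  also have "\<dots> < r * 1" using r by simp
  finally have "r * norm a < r * 1" .
  then have "norm a < 1" by (simp only: mult_less_cancel_left_pos[OF r0])
  then show ?thesis using l(2) by simp
qed

text \<open>
  The vector is \<open>w = \<Sum>\<^sub>m\<^sub><\<^sub>k E\<^sup>m 1\<close>, where \<open>k\<close> is so large that \<open>E\<^sup>k 1 \<le> 1/2\<close>; then
  \<open>E w = w - 1 + E\<^sup>k 1 \<le> w - 1/2\<close>.  Such a \<open>k\<close> exists because \<open>E/r\<close> still has spectral radius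
  below one for some \<open>r < 1\<close>, and so has bounded powers.
\<close>

lemma spectral_radius_less_1_imp_weights:
  fixes e :: "nat \<Rightarrow> nat \<Rightarrow> real"
  assumes n: "0 < n" and e0: "\<And>i j. i < n \<Longrightarrow> j < n \<Longrightarrow> 0 \<le> e i j"
    and sr: "spectral_radius (Matrix.mat n n (\<lambda>(i, j). complex_of_real (e i j))) < 1"
  shows "\<exists>w \<theta>. (\<forall>i<n. 0 < w i) \<and> 0 \<le> \<theta> \<and> \<theta> < 1 \<and> (\<forall>i<n. (\<Sum>j<n. e i j * w j) \<le> \<theta> * w i)"
proof -
  define A where "A = Matrix.mat n n (\<lambda>(i, j). complex_of_real (e i j))"
  have A: "A \<in> carrier_mat n n" by (simp add: A_def)
  define r where "r = (1 + spectral_radius A) / 2"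
  have "0 \<le> spectral_radius A" using spectral_radius_mem_max(1)[OF A n] by auto
  then have r: "0 < r" "r < 1" "spectral_radius A < r"
    using sr unfolding A_def[symmetric] r_def by auto
  define B where "B = Matrix.mat n n (\<lambda>(i, j). complex_of_real (e i j / r))"
  have B: "B \<in> carrier_mat n n" by (simp add: B_def)
  have "A = complex_of_real r \<cdot>\<^sub>m B" using r by (intro eq_matI) (auto simp: A_def B_def)
  then have "spectral_radius B < 1" by (rule spectral_radius_scaled_less_1[OF B n _ r(3)])
  then obtain K where K: "\<And>k. norm_bound (B ^\<^sub>m k) K"
    using spectral_radius_less_1_power_bound[OF B] by blast
  define T where "T x i = (\<Sum>j<n. e i j / r * x j)" for x :: "nat \<Rightarrow> real" and i
  have Tpow: "complex_of_real ((T ^^ k) x i) = (\<Sum>j<n. (B ^\<^sub>m k) $$ (i, j) * complex_of_real (x j))"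
    if "i < n" for k x i
  proof (induction k arbitrary: x)
    case 0
    have "(\<Sum>j<n. (B ^\<^sub>m 0) $$ (i, j) * complex_of_real (x j))
        = (\<Sum>j<n. if j = i then complex_of_real (x i) else 0)"
      using that B by (intro sum.cong) auto
    then show ?case using that by simp
  next
    case (Suc k)
    have "(B ^\<^sub>m Suc k) $$ (i, j) = (\<Sum>l<n. (B ^\<^sub>m k) $$ (i, l) * B $$ (l, j))" if "j < n" for j
      using that \<open>i < n\<close> B by (simp add: scalar_prod_def lessThan_atLeast0)
    then have "(\<Sum>j<n. (B ^\<^sub>m Suc k) $$ (i, j) * complex_of_real (x j))
        = (\<Sum>j<n. \<Sum>l<n. (B ^\<^sub>m k) $$ (i, l) * B $$ (l, j) * complex_of_real (x j))"
      by (simp add: sum_distrib_right)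
    also have "\<dots> = (\<Sum>l<n. \<Sum>j<n. (B ^\<^sub>m k) $$ (i, l) * B $$ (l, j) * complex_of_real (x j))"
      by (rule sum.swap)
    also have "\<dots> = (\<Sum>l<n. (B ^\<^sub>m k) $$ (i, l) * complex_of_real (T x l))"
    proof (rule sum.cong)
      fix l assume "l \<in> {..<n}"
      then have "complex_of_real (T x l) = (\<Sum>j<n. B $$ (l, j) * complex_of_real (x j))"
        by (simp add: T_def B_def)
      then show "(\<Sum>j<n. (B ^\<^sub>m k) $$ (i, l) * B $$ (l, j) * complex_of_real (x j))
          = (B ^\<^sub>m k) $$ (i, l) * complex_of_real (T x l)"
        by (simp only: sum_distrib_left mult.assoc)
    qed simp
    also have "\<dots> = complex_of_real ((T ^^ k) (T x) i)" by (rule Suc.IH[symmetric])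
    finally show ?case by (simp add: funpow_swap1)
  qed
  define v where "v k = (T ^^ k) (\<lambda>_. 1)" for k
  have v_Suc: "v (Suc k) i = (\<Sum>j<n. e i j / r * v k j)" for k i by (simp add: v_def T_def)
  have v0: "0 \<le> v k i" if "i < n" for k i
    using that
  proof (induction k arbitrary: i)
    case (Suc k)
    then show ?case using e0 r by (auto simp: v_Suc intro!: sum_nonneg mult_nonneg_nonneg divide_nonneg_nonneg)
  qed (simp add: v_def)
  have v_le: "v k i \<le> n * K" if i: "i < n" for k i
  proof -
    have "norm (complex_of_real (v k i)) \<le> (\<Sum>j<n. norm ((B ^\<^sub>m k) $$ (i, j)))"
      unfolding v_def Tpow[OF i] by (simp add: norm_sum)
    also have "\<dots> \<le> (\<Sum>j<n. K)"
      using K[of k] i B by (intro sum_mono) (auto simp: norm_bound_def)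
    finally show ?thesis by simp
  qed
  have "(\<lambda>k. r ^ k * (n * K)) \<longlonglongrightarrow> 0 * (n * K)"
    using r by (intro tendsto_mult LIMSEQ_power_zero tendsto_const) auto
  then have "eventually (\<lambda>k. r ^ k * (n * K) < 1/2) sequentially"
    by (intro order_tendstoD) auto
  then have "eventually (\<lambda>k. r ^ k * (n * K) < 1/2 \<and> 1 \<le> k) sequentially"
    using eventually_ge_at_top by (rule eventually_conj)
  then obtain k where k: "r ^ k * (n * K) < 1/2" "1 \<le> k"
    by (metis (no_types, lifting) eventually_happens' sequentially_bot)
  define w where "w i = (\<Sum>m<k. r ^ m * v m i)" for i
  have w1: "1 \<le> w i" if "i < n" for i
  proof -
    have "(\<Sum>m\<in>{0}. r ^ m * v m i) \<le> w i"
      unfolding w_def using k r v0[OF that] by (intro sum_mono2) auto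
    then show ?thesis by (simp add: v_def)
  qed
  define W where "W = (\<Sum>i<n. w i)"
  have wW: "w i \<le> W" if "i < n" for i
    unfolding W_def by (rule member_le_sum) (use that w1 in \<open>auto intro: order_trans[OF zero_le_one]\<close>)
  have W1: "1 \<le> W" using w1[OF n] wW[OF n] by linarith
  have step: "(\<Sum>j<n. e i j * w j) \<le> (1 - 1 / (2 * W)) * w i" if i: "i < n" for i
  proof -
    have "(\<Sum>j<n. e i j * w j) = (\<Sum>m<k. r ^ Suc m * (\<Sum>j<n. e i j / r * v m j))"
      unfolding w_def using r
      by (simp add: sum_distrib_left sum.swap[of _ "{..<k}"]) (simp add: mult_ac)
    also have "\<dots> = (\<Sum>m<k. r ^ Suc m * v (Suc m) i)" by (simp add: v_Suc)
    also have "\<dots> = (\<Sum>m<Suc k. r ^ m * v m i) - v 0 i"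
      by (subst sum.lessThan_Suc_shift) simp
    also have "\<dots> = w i + r ^ k * v k i - 1" by (simp add: w_def v_def)
    also have "r ^ k * v k i \<le> r ^ k * (n * K)" using v_le[OF i] r by (intro mult_left_mono) auto
    finally have "(\<Sum>j<n. e i j * w j) \<le> w i - 1/2" using k(1) by simp
    also have "w i / (2 * W) \<le> 1/2" using wW[OF i] W1 by (simp add: divide_simps)
    then have "w i - 1/2 \<le> (1 - 1 / (2 * W)) * w i" by (simp add: algebra_simps)
    finally show ?thesis .
  qed
  show ?thesis
  proof (intro exI[of _ w] exI[of _ "1 - 1 / (2 * W)"] conjI allI impI)
    show "0 < w i" if "i < n" for i using w1[OF that] by simp
    show "0 \<le> 1 - 1 / (2 * W)" "1 - 1 / (2 * W) < 1" using W1 by (simp_all add: divide_simps)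
  qed (rule step)
qed

section \<open>Decomposition along the marginal subspaces\<close>

text \<open>
  The inequality for \<open>w\<close> is \<open>E w \<le> \<theta> w\<close> with the off-diagonal entries \<open>e\<^sub>i\<^sub>j = 1 - c\<^sub>i\<^sub>j\<close>.
\<close>

locale marginal_system = Lp_prob M p for M :: "'a measure" and p :: ennreal +
  fixes F :: "nat \<Rightarrow> 'a measure" and n :: nat and c :: "nat \<Rightarrow> nat \<Rightarrow> real"
    and w :: "nat \<Rightarrow> real" and \<theta> :: real
  assumes n_pos: "0 < n"
    and sub: "\<And>i. i < n \<Longrightarrow> subalgebra M (F i)"
    and mixing: "\<And>i j. i < n \<Longrightarrow> j < n \<Longrightarrow> i \<noteq> j \<Longrightarrow> mixing_bound (c i j) (F i) (F j)"
    and w_pos: "\<And>i. i < n \<Longrightarrow> 0 < w i" and \<theta>_nonneg: "0 \<le> \<theta>" and \<theta>_less_1: "\<theta> < 1"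
    and weights: "\<And>i. i < n \<Longrightarrow> (\<Sum>j\<in>{..<n} - {i}. (1 - c i j) * w j) \<le> \<theta> * w i"
begin

definition marginal :: "nat \<Rightarrow> real \<Rightarrow> ('a \<Rightarrow> 'k::{banach, second_countable_topology}) \<Rightarrow> bool" where
  "marginal i C z \<longleftrightarrow> z \<in> borel_measurable (F i) \<and> Lp_le M p C z \<and> (LINT x|M. z x) = 0"

lemma marginal_integrable: "marginal i C z \<Longrightarrow> integrable M z"
  by (auto simp: marginal_def intro: Lp_le_integrable)

lemma marginal_measurable: "marginal i C z \<Longrightarrow> z \<in> borel_measurable M"
  using borel_measurable_integrable[OF marginal_integrable] .

lemma marginal_sum:
  fixes z :: "'i \<Rightarrow> 'a \<Rightarrow> 'k::{banach, second_countable_topology}"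
  assumes "finite I" "\<And>j. j \<in> I \<Longrightarrow> marginal i (C j) (z j)"
  shows "marginal i (\<Sum>j\<in>I. C j) (\<lambda>x. \<Sum>j\<in>I. z j x)"
proof -
  have "integrable M (z j)" if "j \<in> I" for j using assms(2)[OF that] by (rule marginal_integrable)
  then have "(LINT x|M. (\<Sum>j\<in>I. z j x)) = (\<Sum>j\<in>I. LINT x|M. z j x)"
    by (intro Bochner_Integration.integral_sum)
  then show ?thesis using assms unfolding marginal_def
    by (auto intro!: Lp_le_sum borel_measurable_sum)
qed

lemma marginal_cond_expectation:
  fixes z :: "'a \<Rightarrow> 'k::euclidean_space"
  assumes ij: "i < n" "j < n" "i \<noteq> j" and z: "marginal j C z"
  shows "marginal i ((1 - c i j) * C) (cond_expectation M (F i) z)"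
    and "annihilates M (F i) (\<lambda>x. z x - cond_expectation M (F i) z x)"
proof -
  note g = cond_expectation[OF sub[OF ij(1)] marginal_integrable[OF z]]
  have "Lp_le M p ((1 - c i j) * C) (\<lambda>x. cond_expectation M (F i) z x - c i j *\<^sub>R (LINT x|M. z x))"
    using z by (intro conditional_expectation_contraction[OF sub[OF ij(1)] sub[OF ij(2)] mixing[OF ij] _ _ g(1,2)])
      (simp_all add: marginal_def)
  then show "marginal i ((1 - c i j) * C) (cond_expectation M (F i) z)"
    using g z by (auto simp: marginal_def)
  show "annihilates M (F i) (\<lambda>x. z x - cond_expectation M (F i) z x)" by (rule g(2))
qed

text \<open>
  Conditioning the sum on \<open>F i\<close> shows \<open>z\<^sub>i = - \<Sum>\<^sub>j\<^sub>\<noteq>\<^sub>i P\<^sub>i z\<^sub>j\<close>, so the norms \<open>N\<^sub>i\<close> of the \<open>z\<^sub>i\<close> satisfy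
  \<open>N \<le> E N\<close>.  At an index \<open>i\<close> that maximises \<open>N\<^sub>i / w\<^sub>i\<close> this gives \<open>N\<^sub>i \<le> \<theta> N\<^sub>i\<close>, hence \<open>N = 0\<close>.
\<close>

theorem marginals_zero_if_sum_annihilated:
  fixes z :: "nat \<Rightarrow> 'a \<Rightarrow> 'k::euclidean_space"
  assumes z: "\<And>i. i < n \<Longrightarrow> \<exists>C. marginal i C (z i)"
    and S: "\<And>i. i < n \<Longrightarrow> annihilates M (F i) (\<lambda>x. \<Sum>j<n. z j x)"
    and k: "k < n"
  shows "AE x in M. z k x = 0"
proof -
  define N where "N i = Lp_seminorm M p (z i)" for i
  have zN: "marginal i (N i) (z i)" if "i < n" for i
    using z[OF that] by (auto simp: marginal_def Lp_le_def N_def)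
  have N_le: "N i \<le> (\<Sum>j\<in>{..<n} - {i}. (1 - c i j) * N j)" if i: "i < n" for i
  proof -
    define g where "g j = cond_expectation M (F i) (z j)" for j
    have g: "marginal i ((1 - c i j) * N j) (g j)" "annihilates M (F i) (\<lambda>x. z j x - g j x)"
      if "j \<in> {..<n} - {i}" for j
      unfolding g_def using that by (auto intro!: marginal_cond_expectation[OF i _ _ zN])
    let ?G = "\<lambda>x. \<Sum>j\<in>{..<n} - {i}. g j x"
    have G: "marginal i (\<Sum>j\<in>{..<n} - {i}. (1 - c i j) * N j) ?G"
      by (rule marginal_sum) (use g(1) in auto)
    have "annihilates M (F i) (\<lambda>x. (\<Sum>j<n. z j x) - (\<Sum>j\<in>{..<n} - {i}. z j x - g j x))"
      by (intro annihilates_diff[OF sub[OF i]] annihilates_sum[OF sub[OF i]] S i g(2)) auto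
    moreover have "(\<Sum>j<n. z j x) - (\<Sum>j\<in>{..<n} - {i}. z j x - g j x) = z i x + ?G x" for x
      using i by (simp add: sum_subtractf sum.remove[of "{..<n}" i])
    ultimately have "annihilates M (F i) (\<lambda>x. z i x + ?G x)" by simp
    then have "AE x in M. z i x + ?G x = 0"
      by (rule annihilates_measurable_zero[OF sub[OF i]])
        (use zN[OF i] G in \<open>auto simp: marginal_def intro!: borel_measurable_add\<close>)
    then have "AE x in M. norm (z i x) \<le> norm (?G x)"
      by eventually_elim (metis add_eq_0_iff norm_minus_cancel order_refl)
    then have "Lp_le M p (\<Sum>j\<in>{..<n} - {i}. (1 - c i j) * N j) (z i)"
      using G by (intro Lp_le_dominated[OF _ marginal_measurable[OF zN[OF i]]]) (simp_all add: marginal_def)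
    then show ?thesis by (simp add: Lp_le_def N_def)
  qed
  obtain i where i: "i < n" "\<And>j. j < n \<Longrightarrow> N j / w j \<le> N i / w i"
  proof -
    have "Max ((\<lambda>j. N j / w j) ` {..<n}) \<in> (\<lambda>j. N j / w j) ` {..<n}"
      using n_pos by (intro Max_in) auto
    then obtain i where "i < n" "Max ((\<lambda>j. N j / w j) ` {..<n}) = N i / w i" by auto
    then show ?thesis using that[of i] Max_ge[of "(\<lambda>j. N j / w j) ` {..<n}"] by auto
  qed
  define t where "t = N i / w i"
  have Nt: "N j \<le> t * w j" if "j < n" for j
    using i(2)[OF that] w_pos[OF that] by (simp add: t_def pos_divide_le_eq)
  have "t * w i = N i" using w_pos[OF i(1)] by (simp add: t_def)
  also have "N i \<le> (\<Sum>j\<in>{..<n} - {i}. (1 - c i j) * N j)" by (rule N_le[OF i(1)])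
  also have "\<dots> \<le> (\<Sum>j\<in>{..<n} - {i}. (1 - c i j) * (t * w j))"
    using mixing[OF i(1)] Nt by (intro sum_mono mult_left_mono) (auto simp: mixing_bound_def)
  also have "\<dots> = t * (\<Sum>j\<in>{..<n} - {i}. (1 - c i j) * w j)"
    by (simp add: sum_distrib_left mult_ac)
  also have "\<dots> \<le> t * (\<theta> * w i)"
    using weights[OF i(1)] w_pos[OF i(1)] Lp_seminorm_nonneg[of "z i"]
    by (intro mult_left_mono) (auto simp: t_def N_def)
  finally have "t * (1 - \<theta>) * w i \<le> 0" by (simp add: algebra_simps)
  then have "t \<le> 0" using w_pos[OF i(1)] \<theta>_less_1 by (simp add: mult_le_0_iff zero_le_mult_iff)
  then have "N k \<le> 0" using Nt[OF k] w_pos[OF k] by (meson less_imp_le mult_nonpos_nonneg order_trans)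
  moreover have "Lp_le M p (N k) (z k)" using zN[OF k] by (simp add: marginal_def)
  ultimately have "Lp_le M p 0 (z k)" by (rule Lp_le_weaken[rotated])
  then show ?thesis using Lp_le_zero_iff Lp_leD_measurable by blast
qed

text \<open>
  The Neumann series: with \<open>y\<^sup>0\<^sub>i = P\<^sub>i (f - E f)\<close> and \<open>y\<^bsup>m+1\<^esup>\<^sub>i = \<Sum>\<^sub>j\<^sub>\<noteq>\<^sub>i P\<^sub>i y\<^bsup>m\<^esup>\<^sub>j\<close>, take
  \<open>z\<^sub>i = \<Sum>\<^sub>m (-1)\<^sup>m y\<^bsup>m\<^esup>\<^sub>i\<close>.  The weights give \<open>\<parallel>y\<^bsup>m\<^esup>\<^sub>i\<parallel>\<^sub>p \<le> \<theta>\<^sup>m D w\<^sub>i\<close>.  The constant is independent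
  of \<open>f\<close> apart from the factor \<open>C\<close>.
\<close>

theorem marginal_decomposition_exists:
  fixes f :: "'a \<Rightarrow> 'k::euclidean_space"
  assumes f: "Lp_le M p C f"
  shows "\<exists>z. (\<forall>i<n. marginal i (2 * C * (\<Sum>j<n. 1 / w j) / (1 - \<theta>) * w i) (z i)) \<and>
    (\<forall>i<n. annihilates M (F i) (\<lambda>x. f x - (LINT x|M. f x) - (\<Sum>j<n. z j x)))"
proof -
  have C: "0 \<le> C" by (rule Lp_le_nonneg) fact
  have fi: "integrable M f" by (rule Lp_le_integrable[OF f])
  define f0 where "f0 x = f x - (LINT x|M. f x)" for x
  have f0i: "integrable M f0" unfolding f0_def using fi by simp
  have Ef0: "(LINT x|M. f0 x) = 0" unfolding f0_def using fi by (simp add: prob_space)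
  have f0: "Lp_le M p (2 * C) f0"
  proof (rule Lp_le_weaken)
    show "Lp_le M p (C + norm (LINT x|M. f x)) f0"
      unfolding f0_def by (rule Lp_le_diff[OF f Lp_le_const])
    have "norm (LINT x|M. f x) \<le> (LINT x|M. norm (f x))" by (rule integral_norm_bound)
    then show "C + norm (LINT x|M. f x) \<le> 2 * C" using Lp_le_integrable(2)[OF f] by linarith
  qed
  have y0: "marginal i (2 * C) (cond_expectation M (F i) f0)" if i: "i < n" for i
  proof -
    note y = cond_expectation[OF sub[OF i] f0i]
    (* the contraction estimate with mixing constant 0, for M itself as second algebra *)
    have "Lp_le M p ((1 - 0) * (2 * C)) (\<lambda>x. cond_expectation M (F i) f0 x - 0 *\<^sub>R (LINT x|M. f0 x))"
      by (rule conditional_expectation_contraction[OF sub[OF i] _ _ _ f0 y(1,2)])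
        (use f0i in \<open>auto simp: subalgebra_def mixing_bound_def\<close>)
    then show ?thesis using y Ef0 by (simp add: marginal_def)
  qed
  define y where "y = rec_nat (\<lambda>i. cond_expectation M (F i) f0)
    (\<lambda>m y i x. \<Sum>j\<in>{..<n} - {i}. cond_expectation M (F i) (y j) x)"
  have y_0: "y 0 i = cond_expectation M (F i) f0" for i by (simp add: y_def)
  have y_Suc: "y (Suc m) i = (\<lambda>x. \<Sum>j\<in>{..<n} - {i}. cond_expectation M (F i) (y m j) x)" for m i
    by (simp add: y_def)
  define D where "D = 2 * C * (\<Sum>j<n. 1 / w j)"
  have D0: "0 \<le> D" unfolding D_def using C w_pos by (intro mult_nonneg_nonneg sum_nonneg) (auto intro: less_imp_le)
  have marg: "marginal i (\<theta> ^ m * (D * w i)) (y m i)" if "i < n" for i m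
    using that
  proof (induction m arbitrary: i)
    case (0 i)
    have "1 / w i \<le> (\<Sum>j<n. 1 / w j)"
      by (rule member_le_sum) (use 0 w_pos in \<open>auto intro: less_imp_le\<close>)
    then have "1 / w i * w i \<le> (\<Sum>j<n. 1 / w j) * w i"
      using w_pos[OF 0] by (intro mult_right_mono) auto
    then have "2 * C * 1 \<le> 2 * C * ((\<Sum>j<n. 1 / w j) * w i)"
      using w_pos[OF 0] C by (intro mult_left_mono) auto
    then have "2 * C \<le> D * w i" by (simp add: D_def mult_ac)
    then show ?case using y0[OF 0] by (auto simp: y_0 marginal_def intro: Lp_le_weaken)
  next
    case (Suc m i)
    have "marginal i (\<Sum>j\<in>{..<n} - {i}. (1 - c i j) * (\<theta> ^ m * (D * w j))) (y (Suc m) i)"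
      unfolding y_Suc by (intro marginal_sum marginal_cond_expectation(1) Suc) auto
    moreover have "(\<Sum>j\<in>{..<n} - {i}. (1 - c i j) * (\<theta> ^ m * (D * w j)))
        = \<theta> ^ m * D * (\<Sum>j\<in>{..<n} - {i}. (1 - c i j) * w j)"
      by (simp add: sum_distrib_left mult_ac)
    moreover have "\<dots> \<le> \<theta> ^ m * D * (\<theta> * w i)"
      using weights[OF Suc.prems] \<theta>_nonneg D0 by (intro mult_left_mono) auto
    ultimately show ?case by (auto simp: marginal_def mult_ac intro: Lp_le_weaken)
  qed
  have ann: "annihilates M (F i) (\<lambda>x. (\<Sum>j\<in>{..<n} - {i}. y m j x) - y (Suc m) i x)" if i: "i < n" for i m
  proof -
    have "annihilates M (F i) (\<lambda>x. \<Sum>j\<in>{..<n} - {i}. y m j x - cond_expectation M (F i) (y m j) x)"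
      by (intro annihilates_sum[OF sub[OF i]] marginal_cond_expectation(2)[OF i _ _ marg]) auto
    then show ?thesis by (simp add: y_Suc sum_subtractf)
  qed
  define a where "a m i x = (- 1) ^ m *\<^sub>R y m i x" for m i x
  define z where "z i x = (\<Sum>m. a m i x)" for i x
  have aL: "Lp_le M p (\<theta> ^ m * (D * w i)) (a m i)" if "i < n" for m i
  proof (rule Lp_le_dominated)
    show "Lp_le M p (\<theta> ^ m * (D * w i)) (y m i)" using marg[OF that] by (simp add: marginal_def)
    show "a m i \<in> borel_measurable M"
      unfolding a_def using marginal_measurable[OF marg[OF that]] by measurable
  qed (simp add: a_def)
  note series = Lp_le_geometric_series[OF \<theta>_nonneg \<theta>_less_1 aL]
  have "marginal i (D / (1 - \<theta>) * w i) (z i)" if i: "i < n" for i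
  proof -
    have "z i \<in> borel_measurable (F i)"
      unfolding z_def a_def using marg[OF i]
      by (intro borel_measurable_suminf borel_measurable_scaleR borel_measurable_const) (simp_all add: marginal_def)
    moreover have "Lp_le M p (D / (1 - \<theta>) * w i) (z i)"
      using series(3)[OF i] by (simp add: z_def[abs_def])
    moreover have "(LINT x|M. z i x) = (\<Sum>m. LINT x|M. a m i x)"
      unfolding z_def by (rule integral_suminf[OF Lp_le_integrable(1)[OF aL[OF i]] series(2)[OF i] series(1)[OF i]])
    moreover have "(LINT x|M. a m i x) = 0" for m
      using marg[OF i, of m] by (simp add: a_def marginal_def)
    ultimately show ?thesis by (simp add: marginal_def)
  qed
  moreover have "annihilates M (F i) (\<lambda>x. f0 x - (\<Sum>j<n. z j x))" if i: "i < n" for i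
  proof -
    (* the terms of the series of z telescope, up to y 0 i, into functions annihilated by F i *)
    define h where "h m x = (- 1) ^ m *\<^sub>R ((\<Sum>j\<in>{..<n} - {i}. y m j x) - y (Suc m) i x)" for m x
    have hA: "annihilates M (F i) (h m)" for m
      unfolding h_def by (rule annihilates_bounded_linear[OF sub[OF i] bounded_linear_scaleR_right ann[OF i]])
    have hL: "Lp_le M p (\<theta> ^ m * ((\<Sum>j\<in>{..<n} - {i}. D * w j) + \<theta> * (D * w i))) (h m)" for m
    proof -
      have "Lp_le M p ((\<Sum>j\<in>{..<n} - {i}. \<theta> ^ m * (D * w j)) + \<theta> ^ Suc m * (D * w i))
          (\<lambda>x. (\<Sum>j\<in>{..<n} - {i}. y m j x) - y (Suc m) i x)"
      proof (rule Lp_le_diff[OF Lp_le_sum[where a = "\<lambda>j. \<theta> ^ m * (D * w j)"]])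
        show "Lp_le M p (\<theta> ^ m * (D * w j)) (y m j)" if "j \<in> {..<n} - {i}" for j
          using marg[of j m] that by (simp add: marginal_def)
        show "Lp_le M p (\<theta> ^ Suc m * (D * w i)) (y (Suc m) i)"
          using marg[OF i, of "Suc m"] unfolding marginal_def by blast
      qed simp
      then have "Lp_le M p ((\<Sum>j\<in>{..<n} - {i}. \<theta> ^ m * (D * w j)) + \<theta> ^ Suc m * (D * w i)) (h m)"
        by (rule Lp_le_dominated[OF _ borel_measurable_integrable[OF annihilates_integrable[OF hA]]])
          (simp add: h_def)
      then show ?thesis by (simp add: distrib_left sum_distrib_left mult_ac)
    qed
    note hs = Lp_le_geometric_series[OF \<theta>_nonneg \<theta>_less_1 hL]
    have hA': "annihilates M (F i) (\<lambda>x. \<Sum>m. h m x)"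
      by (rule annihilates_suminf[OF sub[OF i] hA hs(2,1)])
    have "AE x in M. \<forall>j\<in>{..<n}. summable (\<lambda>m. norm (a m j x))"
      using series(2) by (simp add: AE_finite_all)
    then have eq: "AE x in M. f0 x - (\<Sum>j<n. z j x) = (f0 x - y 0 i x) - (\<Sum>m. h m x)"
    proof eventually_elim
      case (elim x)
      then have s: "summable (\<lambda>m. a m j x)" if "j < n" for j using that by (intro summable_norm_cancel[of "\<lambda>m. a m j x"]) simp
      have "h m x = (\<Sum>j\<in>{..<n} - {i}. a m j x) + a (Suc m) i x" for m
        by (simp add: h_def a_def scaleR_diff_right scaleR_sum_right)
      then have "(\<Sum>m. h m x) = (\<Sum>m. (\<Sum>j\<in>{..<n} - {i}. a m j x) + a (Suc m) i x)" by simp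
      also have "\<dots> = (\<Sum>m. \<Sum>j\<in>{..<n} - {i}. a m j x) + (\<Sum>m. a (Suc m) i x)"
        using s i by (intro suminf_add[symmetric] summable_sum) (auto simp: summable_Suc_iff[of "\<lambda>m. a m i x"])
      also have "(\<Sum>m. \<Sum>j\<in>{..<n} - {i}. a m j x) = (\<Sum>j\<in>{..<n} - {i}. z j x)"
        unfolding z_def using s by (intro suminf_sum) auto
      also have "(\<Sum>m. a (Suc m) i x) = z i x - y 0 i x"
        unfolding z_def suminf_split_head[OF s[OF i]] by (simp add: a_def)
      finally show ?case using i by (simp add: sum.remove[of "{..<n}" i])
    qed
    have "annihilates M (F i) (\<lambda>x. (f0 x - y 0 i x) - (\<Sum>m. h m x))"
      unfolding y_0 by (intro annihilates_diff[OF sub[OF i] _ hA'] cond_expectation(2)[OF sub[OF i] f0i])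
    moreover have "(\<lambda>x. f0 x - (\<Sum>j<n. z j x)) \<in> borel_measurable M"
      unfolding z_def
      by (intro borel_measurable_diff borel_measurable_sum borel_measurable_suminf
          borel_measurable_integrable[OF f0i] Lp_leD_measurable[OF aL]) simp
    ultimately show ?thesis using annihilates_cong[OF sub[OF i] _ _ eq] by blast
  qed
  ultimately show ?thesis unfolding f0_def D_def by blast
qed

end

section \<open>Equivalence classes and the projection\<close>

context Lp_prob
begin

lemma ae_rep_in_Lp_functions:
  fixes X :: "('a \<Rightarrow> 'k::{banach, second_countable_topology}) set"
  assumes X: "X \<in> Lp M p"
  shows "ae_rep X \<in> Lp_functions M p" and "ae_class M (ae_rep X) = X"
proof -
  obtain f where f: "f \<in> Lp_functions M p" "X = ae_class M f" using X by (auto simp: Lp_def)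
  have fM: "f \<in> borel_measurable M" using f(1) by (simp add: Lp_functions_def)
  note r = ae_rep_ae_class[OF fM, folded f(2)]
  have "Lp_le M p (Lp_seminorm M p f) (ae_rep X)" by (rule Lp_le_cong[OF Lp_le_self[OF f(1)] r])
  then show "ae_rep X \<in> Lp_functions M p" by (simp add: Lp_le_def)
  show "ae_class M (ae_rep X) = X" unfolding f(2) using r(2) by (intro ae_class_eqI) (simp add: f(2))
qed

lemma Lp_functions_measurable: "f \<in> Lp_functions M p \<Longrightarrow> f \<in> borel_measurable M"
  by (simp add: Lp_functions_def)

lemma Lp_functions_add:
  fixes f g :: "'a \<Rightarrow> 'k::{banach, second_countable_topology}"
  assumes "f \<in> Lp_functions M p" "g \<in> Lp_functions M p"
  shows "(\<lambda>x. f x + g x) \<in> Lp_functions M p"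
  using Lp_le_add[OF Lp_le_self[OF assms(1)] Lp_le_self[OF assms(2)]] by (simp add: Lp_le_def)

lemma Lp_functions_diff:
  fixes f g :: "'a \<Rightarrow> 'k::{banach, second_countable_topology}"
  assumes "f \<in> Lp_functions M p" "g \<in> Lp_functions M p"
  shows "(\<lambda>x. f x - g x) \<in> Lp_functions M p"
  using Lp_le_diff[OF Lp_le_self[OF assms(1)] Lp_le_self[OF assms(2)]] by (simp add: Lp_le_def)

lemma Lp_functions_scale:
  fixes f :: "'a \<Rightarrow> 'k::{banach, second_countable_topology, real_normed_field}"
  assumes "f \<in> Lp_functions M p"
  shows "(\<lambda>x. c * f x) \<in> Lp_functions M p"
  using Lp_le_scale[OF Lp_le_self[OF assms]] by (simp add: Lp_le_def)

lemma Lp_norm_ae_class_le: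
  fixes f :: "'a \<Rightarrow> 'k::{banach, second_countable_topology}"
  assumes "Lp_le M p C f"
  shows "Lp_norm M p (ae_class M f) \<le> C"
  using assms by (simp add: Lp_norm_ae_class Lp_leD_measurable) (simp add: Lp_le_def)

text \<open>
  Symmetry of the distance is required for arbitrary sets of functions.  If no measurable function
  represents the difference, both differences are the empty set.
\<close>

lemma ae_diff_commute_norm:
  fixes X Y :: "('a \<Rightarrow> 'k::{banach, second_countable_topology}) set"
  shows "Lp_norm M p (ae_diff M X Y) = Lp_norm M p (ae_diff M Y X)"
proof -
  have half: "\<exists>g. g \<in> borel_measurable M \<and> ae_diff M X Y = ae_class M g \<and> ae_diff M Y X = ae_class M (\<lambda>x. - g x)"
    if ne: "ae_diff M X Y \<noteq> {}" for X Y :: "('a \<Rightarrow> 'k) set"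
  proof -
    obtain g where g: "g \<in> borel_measurable M" "AE x in M. g x = ae_rep X x - ae_rep Y x"
      using ne by (auto simp: ae_diff_def ae_class_def)
    have "ae_diff M X Y = ae_class M g" unfolding ae_diff_def by (rule ae_class_eqI[symmetric]) (rule g(2))
    moreover have "ae_diff M Y X = ae_class M (\<lambda>x. - g x)"
      unfolding ae_diff_def by (rule ae_class_eqI) (use g(2) in eventually_elim, simp)
    ultimately show ?thesis using g(1) by blast
  qed
  have neg: "Lp_norm M p (ae_class M (\<lambda>x. - g x)) = Lp_norm M p (ae_class M g)"
    if "g \<in> borel_measurable M" for g :: "'a \<Rightarrow> 'k"
    using that by (simp add: Lp_norm_ae_class Lp_seminorm_def)
  show ?thesis
  proof (cases "ae_diff M X Y = {} \<and> ae_diff M Y X = {}")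
    case False
    then show ?thesis using half[of X Y] half[of Y X] neg by metis
  qed simp
qed

lemma Metric_space_Lp:
  "Metric_space (Lp M p :: ('a \<Rightarrow> 'k::{banach, second_countable_topology}) set set)
    (\<lambda>X Y. Lp_norm M p (ae_diff M X Y))"
proof
  fix X Y Z :: "('a \<Rightarrow> 'k) set"
  show "0 \<le> Lp_norm M p (ae_diff M X Y)" by (simp add: Lp_norm_def Lp_seminorm_nonneg)
  show "Lp_norm M p (ae_diff M X Y) = Lp_norm M p (ae_diff M Y X)" by (rule ae_diff_commute_norm)
  assume X: "X \<in> Lp M p" and Y: "Y \<in> Lp M p"
  let ?f = "ae_rep X" and ?g = "ae_rep Y"
  note fg = ae_rep_in_Lp_functions[OF X] ae_rep_in_Lp_functions[OF Y]
  have meas: "?f \<in> borel_measurable M" "?g \<in> borel_measurable M"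
    using fg by (auto intro: Lp_functions_measurable)
  have d: "Lp_norm M p (ae_diff M X Y) = Lp_seminorm M p (\<lambda>x. ?f x - ?g x)"
    unfolding ae_diff_def using meas by (intro Lp_norm_ae_class) measurable
  have "Lp_seminorm M p (\<lambda>x. ?f x - ?g x) = 0 \<longleftrightarrow> Lp_le M p 0 (\<lambda>x. ?f x - ?g x)"
    using Lp_functions_diff[OF fg(1,3)] Lp_seminorm_nonneg[of "\<lambda>x. ?f x - ?g x"]
    by (auto simp: Lp_le_def)
  also have "\<dots> \<longleftrightarrow> (AE x in M. ?f x - ?g x = 0)" using meas by (intro Lp_le_zero_iff) measurable
  also have "\<dots> \<longleftrightarrow> X = Y" using ae_class_eq_iff[OF meas(1), of ?g] fg(2,4) by simp
  finally show "Lp_norm M p (ae_diff M X Y) = 0 \<longleftrightarrow> X = Y" by (simp add: d)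
  assume Z: "Z \<in> Lp M p"
  let ?h = "ae_rep Z"
  note h = ae_rep_in_Lp_functions[OF Z]
  have hm: "?h \<in> borel_measurable M" using h by (auto intro: Lp_functions_measurable)
  have "Lp_le M p (Lp_seminorm M p (\<lambda>x. ?f x - ?g x) + Lp_seminorm M p (\<lambda>x. ?g x - ?h x))
      (\<lambda>x. (?f x - ?g x) + (?g x - ?h x))"
    by (intro Lp_le_add Lp_le_self Lp_functions_diff fg h)
  then have "Lp_seminorm M p (\<lambda>x. ?f x - ?h x)
      \<le> Lp_seminorm M p (\<lambda>x. ?f x - ?g x) + Lp_seminorm M p (\<lambda>x. ?g x - ?h x)"
    by (simp add: Lp_le_def)
  moreover have "Lp_norm M p (ae_diff M Y Z) = Lp_seminorm M p (\<lambda>x. ?g x - ?h x)"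
    unfolding ae_diff_def using meas hm by (intro Lp_norm_ae_class) measurable
  moreover have "Lp_norm M p (ae_diff M X Z) = Lp_seminorm M p (\<lambda>x. ?f x - ?h x)"
    unfolding ae_diff_def using meas hm by (intro Lp_norm_ae_class) measurable
  ultimately show "Lp_norm M p (ae_diff M X Z) \<le> Lp_norm M p (ae_diff M X Y) + Lp_norm M p (ae_diff M Y Z)"
    by (simp add: d)
qed

lemma Lp0_sub_iff:
  fixes X :: "('a \<Rightarrow> 'k::{banach, second_countable_topology}) set"
  assumes A: "subalgebra M A"
  shows "X \<in> Lp0_sub M p A \<longleftrightarrow>
    (\<exists>f. f \<in> Lp_functions M p \<and> f \<in> borel_measurable A \<and> (LINT x|M. f x) = 0 \<and> X = ae_class M f)"
proof
  assume "X \<in> Lp0_sub M p A"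
  then have XL: "X \<in> Lp M p" and E: "class_expectation M X = 0" and "\<exists>f\<in>X. f \<in> borel_measurable A"
    by (auto simp: Lp0_sub_def Lp_sub_def)
  then obtain f where f: "f \<in> X" "f \<in> borel_measurable A" by blast
  note r = ae_rep_in_Lp_functions[OF XL]
  have fM: "f \<in> borel_measurable M" and ae: "AE x in M. f x = ae_rep X x"
    using f(1) r(2)[symmetric] by (auto simp: ae_class_def)
  have Xf: "X = ae_class M f" using r(2) ae_class_eqI[OF ae] by simp
  have "Lp_le M p (Lp_seminorm M p (ae_rep X)) f" by (rule Lp_le_cong[OF Lp_le_self[OF r(1)] fM ae])
  then show "\<exists>f. f \<in> Lp_functions M p \<and> f \<in> borel_measurable A \<and> (LINT x|M. f x) = 0 \<and> X = ae_class M f"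
    using f(2) Xf E class_expectation_ae_class[OF fM] by (auto simp: Lp_le_def)
next
  assume "\<exists>f. f \<in> Lp_functions M p \<and> f \<in> borel_measurable A \<and> (LINT x|M. f x) = 0 \<and> X = ae_class M f"
  then obtain f where f: "f \<in> Lp_functions M p" "f \<in> borel_measurable A" "(LINT x|M. f x) = 0" "X = ae_class M f"
    by blast
  have fM: "f \<in> borel_measurable M" by (rule Lp_functions_measurable[OF f(1)])
  have "f \<in> X" using fM by (simp add: f(4) ae_class_def)
  then show "X \<in> Lp0_sub M p A" using f fM
    by (auto simp: Lp0_sub_def Lp_sub_def Lp_def class_expectation_ae_class)
qed

end

context marginal_system
begin

definition marginal_combination :: "('a \<Rightarrow> 'k::{banach, second_countable_topology}) \<Rightarrow> bool" where
  "marginal_combination S \<longleftrightarrow> S \<in> borel_measurable M \<and>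
     (\<exists>z. (\<forall>i<n. \<exists>C. marginal i C (z i)) \<and> (AE x in M. S x = (\<Sum>i<n. z i x)))"

text \<open>
  \<open>S\<close> is the value of the projection at \<open>f\<close>: the element of the sum of the marginal subspaces with the
  same conditional expectations given each \<open>F i\<close> as the centred function \<open>f - E f\<close>.  It is unique up to
  null sets.
\<close>

definition marginal_part ::
    "('a \<Rightarrow> 'k::{banach, second_countable_topology}) \<Rightarrow> ('a \<Rightarrow> 'k) \<Rightarrow> bool" where
  "marginal_part f S \<longleftrightarrow> marginal_combination S \<and>
     (\<forall>i<n. annihilates M (F i) (\<lambda>x. f x - (LINT x|M. f x) - S x))"

lemma marginal_combination_Lp:
  fixes S :: "'a \<Rightarrow> 'k::{banach, second_countable_topology}"
  assumes "marginal_combination S"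
  shows "S \<in> Lp_functions M p" and "(LINT x|M. S x) = 0"
proof -
  obtain z where SM: "S \<in> borel_measurable M" and z: "\<forall>i<n. \<exists>C. marginal i C (z i)"
    and S: "AE x in M. S x = (\<Sum>i<n. z i x)"
    using assms by (auto simp: marginal_combination_def)
  from z obtain C where C: "\<And>i. i < n \<Longrightarrow> marginal i (C i) (z i)" by metis
  have L: "Lp_le M p (\<Sum>i<n. C i) (\<lambda>x. \<Sum>i<n. z i x)"
    by (rule Lp_le_sum) (use C in \<open>auto simp: marginal_def\<close>)
  then have "Lp_le M p (\<Sum>i<n. C i) S" by (rule Lp_le_cong[OF _ SM S])
  then show "S \<in> Lp_functions M p" by (simp add: Lp_le_def)
  have "(LINT x|M. S x) = (LINT x|M. (\<Sum>i<n. z i x))"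
    by (rule integral_cong_AE[OF SM Lp_leD_measurable[OF L] S])
  also have "\<dots> = (\<Sum>i<n. LINT x|M. z i x)"
    by (rule Bochner_Integration.integral_sum) (use C marginal_integrable in blast)
  also have "\<dots> = 0" using C by (intro sum.neutral) (auto simp: marginal_def)
  finally show "(LINT x|M. S x) = 0" .
qed

lemma marginal_combination_linear:
  fixes S T :: "'a \<Rightarrow> 'k::{banach, second_countable_topology, real_normed_field}"
  assumes S: "marginal_combination S" and T: "marginal_combination T"
  shows "marginal_combination (\<lambda>x. a * S x + b * T x)"
proof -
  obtain y where [measurable]: "S \<in> borel_measurable M" and y: "\<forall>i<n. \<exists>C. marginal i C (y i)"
    and Sy: "AE x in M. S x = (\<Sum>i<n. y i x)"
    using S by (auto simp: marginal_combination_def)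
  obtain z where [measurable]: "T \<in> borel_measurable M" and z: "\<forall>i<n. \<exists>C. marginal i C (z i)"
    and Tz: "AE x in M. T x = (\<Sum>i<n. z i x)"
    using T by (auto simp: marginal_combination_def)
  have "\<exists>C. marginal i C (\<lambda>x. a * y i x + b * z i x)" if i: "i < n" for i
  proof -
    obtain C D where C: "marginal i C (y i)" and D: "marginal i D (z i)" using y z i by blast
    have "Lp_le M p (norm a * C + norm b * D) (\<lambda>x. a * y i x + b * z i x)"
      using C D by (intro Lp_le_add Lp_le_scale) (auto simp: marginal_def)
    moreover have "(LINT x|M. a * y i x + b * z i x) = a * (LINT x|M. y i x) + b * (LINT x|M. z i x)"
      using marginal_integrable[OF C] marginal_integrable[OF D] by simp
    moreover have "(\<lambda>x. a * y i x + b * z i x) \<in> borel_measurable (F i)"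
      using C D by (intro borel_measurable_add borel_measurable_times borel_measurable_const)
        (simp_all add: marginal_def)
    ultimately have "marginal i (norm a * C + norm b * D) (\<lambda>x. a * y i x + b * z i x)"
      using C D unfolding marginal_def by simp
    then show ?thesis by blast
  qed
  moreover have "AE x in M. a * S x + b * T x = (\<Sum>i<n. a * y i x + b * z i x)"
    using Sy Tz by eventually_elim (simp add: sum.distrib sum_distrib_left)
  moreover have "(\<lambda>x. a * S x + b * T x) \<in> borel_measurable M" by measurable
  ultimately show ?thesis unfolding marginal_combination_def by (intro conjI exI[of _ "\<lambda>i x. a * y i x + b * z i x"]) auto
qed

lemma marginal_part_linear:
  fixes f g S T :: "'a \<Rightarrow> 'k::{banach, second_countable_topology, real_normed_field}"
  assumes f: "integrable M f" "marginal_part f S" and g: "integrable M g" "marginal_part g T"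
  shows "marginal_part (\<lambda>x. a * f x + b * g x) (\<lambda>x. a * S x + b * T x)"
  unfolding marginal_part_def
proof (intro conjI allI impI)
  show "marginal_combination (\<lambda>x. a * S x + b * T x)"
    using f g by (intro marginal_combination_linear) (auto simp: marginal_part_def)
  fix i assume i: "i < n"
  have "annihilates M (F i) (\<lambda>x. a * (f x - (LINT x|M. f x) - S x) + b * (g x - (LINT x|M. g x) - T x))"
    using f g i by (intro annihilates_add[OF sub[OF i]]
        annihilates_bounded_linear[OF sub[OF i] bounded_linear_mult_right]) (auto simp: marginal_part_def)
  moreover have "(LINT x|M. a * f x + b * g x) = a * (LINT x|M. f x) + b * (LINT x|M. g x)"
    using f g by simp
  ultimately show "annihilates M (F i) (\<lambda>x. a * f x + b * g x - (LINT x|M. a * f x + b * g x) - (a * S x + b * T x))"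
    by (simp add: algebra_simps)
qed

lemma marginal_part_exists:
  fixes f :: "'a \<Rightarrow> 'k::euclidean_space"
  assumes f: "Lp_le M p C f"
  shows "\<exists>S. marginal_part f S \<and>
    Lp_le M p ((\<Sum>i<n. 2 * (\<Sum>j<n. 1 / w j) / (1 - \<theta>) * w i) * C) S"
proof -
  obtain z where z: "\<forall>i<n. marginal i (2 * C * (\<Sum>j<n. 1 / w j) / (1 - \<theta>) * w i) (z i)"
    and ann: "\<forall>i<n. annihilates M (F i) (\<lambda>x. f x - (LINT x|M. f x) - (\<Sum>j<n. z j x))"
    using marginal_decomposition_exists[OF f] by blast
  let ?S = "\<lambda>x. \<Sum>j<n. z j x"
  have L: "Lp_le M p (\<Sum>i<n. 2 * C * (\<Sum>j<n. 1 / w j) / (1 - \<theta>) * w i) ?S"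
    by (rule Lp_le_sum) (use z in \<open>auto simp: marginal_def\<close>)
  moreover have "(\<Sum>i<n. 2 * C * (\<Sum>j<n. 1 / w j) / (1 - \<theta>) * w i)
      = (\<Sum>i<n. 2 * (\<Sum>j<n. 1 / w j) / (1 - \<theta>) * w i) * C"
    unfolding sum_distrib_right by (rule sum.cong) (simp_all add: mult_ac)
  moreover have "marginal_part f ?S"
    unfolding marginal_part_def marginal_combination_def
    using z ann Lp_leD_measurable[OF L] by blast
  ultimately show ?thesis by metis
qed

lemma marginal_combination_zero:
  fixes S :: "'a \<Rightarrow> 'k::euclidean_space"
  assumes S: "marginal_combination S" and ann: "\<And>i. i < n \<Longrightarrow> annihilates M (F i) S"
  shows "AE x in M. S x = 0"
proof -
  obtain z where SM: "S \<in> borel_measurable M" and z: "\<forall>i<n. \<exists>C. marginal i C (z i)"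
    and Sz: "AE x in M. S x = (\<Sum>i<n. z i x)"
    using S by (auto simp: marginal_combination_def)
  have zm: "(\<lambda>x. \<Sum>i<n. z i x) \<in> borel_measurable M"
    using z by (intro borel_measurable_sum) (auto intro: marginal_measurable)
  have zS: "AE x in M. (\<Sum>i<n. z i x) = S x" using Sz by eventually_elim simp
  have "AE x in M. z k x = 0" if "k < n" for k
    using z by (intro marginals_zero_if_sum_annihilated[OF _ _ that] annihilates_cong[OF sub ann zm zS]) auto
  then have "AE x in M. \<forall>k\<in>{..<n}. z k x = 0" by (simp add: AE_finite_all)
  with Sz show ?thesis by eventually_elim simp
qed

text \<open>
  By linearity \<open>S - T\<close> is a marginal part of \<open>f - g\<close>, which vanishes almost everywhere.
\<close>

lemma marginal_part_unique:
  fixes f g S T :: "'a \<Rightarrow> 'k::{euclidean_space, real_normed_field}"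
  assumes f: "integrable M f" "marginal_part f S" and g: "integrable M g" "marginal_part g T"
    and eq: "AE x in M. f x = g x"
  shows "AE x in M. S x = T x"
proof -
  note D = marginal_part_linear[OF f g, of 1 "- 1"]
  have C: "marginal_combination (\<lambda>x. S x - T x)" using D by (simp add: marginal_part_def)
  have E: "(LINT x|M. f x - g x) = 0"
  proof -
    have "(LINT x|M. f x) = (LINT x|M. g x)"
      using f(1) g(1) eq by (intro integral_cong_AE) auto
    then show ?thesis using f(1) g(1) by simp
  qed
  have "annihilates M (F i) (\<lambda>x. S x - T x)" if i: "i < n" for i
  proof (rule annihilates_cong[OF sub[OF i]])
    have "annihilates M (F i) (\<lambda>x. f x - g x - (S x - T x))"
      using D i E by (simp add: marginal_part_def)
    then show "annihilates M (F i) (\<lambda>x. - (f x - g x - (S x - T x)))"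
      by (rule annihilates_minus[OF sub[OF i]])
    show "(\<lambda>x. S x - T x) \<in> borel_measurable M" using C by (simp add: marginal_combination_def)
    show "AE x in M. S x - T x = - (f x - g x - (S x - T x))" using eq by eventually_elim simp
  qed
  then have "AE x in M. S x - T x = 0" by (rule marginal_combination_zero[OF C])
  then show ?thesis by simp
qed

text \<open>
  Elements of the sum have mean zero, so the projection fixes them.
\<close>

lemma marginal_part_self:
  fixes S :: "'a \<Rightarrow> 'k::{banach, second_countable_topology}"
  assumes "marginal_combination S"
  shows "marginal_part S S"
  using assms marginal_combination_Lp(2)[OF assms] by (simp add: marginal_part_def annihilates_zero)

lemma sum_of_marginals_iff:
  fixes X :: "('a \<Rightarrow> 'k::{banach, second_countable_topology}) set"
  shows "X \<in> sum_of_subspaces M {..<n} (\<lambda>i. Lp0_sub M p (F i)) \<longleftrightarrow>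
    (\<exists>S. marginal_combination S \<and> X = ae_class M S)"
proof
  assume "X \<in> sum_of_subspaces M {..<n} (\<lambda>i. Lp0_sub M p (F i))"
  then obtain Y where Y: "\<forall>i\<in>{..<n}. Y i \<in> Lp0_sub M p (F i)" and X: "X = ae_sum M {..<n} Y"
    by (auto simp: sum_of_subspaces_def)
  have "\<forall>i\<in>{..<n}. \<exists>f. f \<in> Lp_functions M p \<and> f \<in> borel_measurable (F i) \<and> (LINT x|M. f x) = 0 \<and> Y i = ae_class M f"
    using Y Lp0_sub_iff[OF sub] by blast
  then obtain z where z: "\<And>i. i < n \<Longrightarrow> z i \<in> Lp_functions M p \<and> z i \<in> borel_measurable (F i) \<and>
      (LINT x|M. z i x) = 0 \<and> Y i = ae_class M (z i)" by (metis lessThan_iff)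
  have zM: "z i \<in> borel_measurable M" if "i < n" for i using z[OF that] Lp_functions_measurable by blast
  have "X = ae_sum M {..<n} (\<lambda>i. ae_class M (z i))" unfolding X ae_sum_def using z by (intro arg_cong[where f = "ae_class M"] ext sum.cong) auto
  also have "\<dots> = ae_class M (\<lambda>x. \<Sum>i<n. z i x)" by (rule ae_sum_ae_class) (use zM in auto)
  finally have "X = ae_class M (\<lambda>x. \<Sum>i<n. z i x)" .
  moreover have "\<exists>C. marginal i C (z i)" if "i < n" for i
    using z[OF that] Lp_le_self by (auto simp: marginal_def)
  then have "marginal_combination (\<lambda>x. \<Sum>i<n. z i x)"
    unfolding marginal_combination_def using zM by (auto intro!: borel_measurable_sum exI[of _ z])
  ultimately show "\<exists>S. marginal_combination S \<and> X = ae_class M S" by blast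
next
  assume "\<exists>S. marginal_combination S \<and> X = ae_class M S"
  then obtain S z where X: "X = ae_class M S" and z: "\<forall>i<n. \<exists>C. marginal i C (z i)"
    and S: "AE x in M. S x = (\<Sum>i<n. z i x)"
    by (auto simp: marginal_combination_def)
  have "X = ae_class M (\<lambda>x. \<Sum>i<n. z i x)" unfolding X by (rule ae_class_eqI[OF S])
  also have "\<dots> = ae_sum M {..<n} (\<lambda>i. ae_class M (z i))"
    by (rule ae_sum_ae_class[symmetric]) (use z in \<open>auto intro: marginal_measurable\<close>)
  finally have "X = ae_sum M {..<n} (\<lambda>i. ae_class M (z i))" .
  moreover have "ae_class M (z i) \<in> Lp0_sub M p (F i)" if "i < n" for i
    unfolding Lp0_sub_iff[OF sub[OF that]] using z that by (auto simp: marginal_def Lp_le_def)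
  ultimately show "X \<in> sum_of_subspaces M {..<n} (\<lambda>i. Lp0_sub M p (F i))"
    by (auto simp: sum_of_subspaces_def)
qed

theorem marginals_independent:
  "independent_subspaces M {..<n} (\<lambda>i. Lp0_sub M p (F i) :: ('a \<Rightarrow> 'k::euclidean_space) set set)"
  unfolding independent_subspaces_def
proof (intro allI impI)
  fix Y :: "nat \<Rightarrow> ('a \<Rightarrow> 'k) set"
  assume Y: "(\<forall>i\<in>{..<n}. Y i \<in> Lp0_sub M p (F i)) \<and> ae_sum M {..<n} Y = ae_zero M"
  then have "\<forall>i\<in>{..<n}. \<exists>f. f \<in> Lp_functions M p \<and> f \<in> borel_measurable (F i) \<and> (LINT x|M. f x) = 0 \<and> Y i = ae_class M f"
    using Lp0_sub_iff[OF sub] by blast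
  then obtain z where z: "\<And>i. i < n \<Longrightarrow> z i \<in> Lp_functions M p \<and> z i \<in> borel_measurable (F i) \<and>
      (LINT x|M. z i x) = 0 \<and> Y i = ae_class M (z i)" by (metis lessThan_iff)
  have zM: "z i \<in> borel_measurable M" if "i < n" for i using z[OF that] Lp_functions_measurable by blast
  have sm: "(\<lambda>x. \<Sum>i<n. z i x) \<in> borel_measurable M" using zM by (intro borel_measurable_sum) auto
  have "ae_sum M {..<n} Y = ae_sum M {..<n} (\<lambda>i. ae_class M (z i))"
    unfolding ae_sum_def using z by (intro arg_cong[where f = "ae_class M"] ext sum.cong) auto
  also have "\<dots> = ae_class M (\<lambda>x. \<Sum>i<n. z i x)" by (rule ae_sum_ae_class) (use zM in auto)
  finally have "AE x in M. (\<Sum>i<n. z i x) = 0"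
    using Y ae_class_eq_iff[OF sm, of "\<lambda>_. 0"] by (simp add: ae_zero_def)
  then have ann: "annihilates M (F i) (\<lambda>x. \<Sum>j<n. z j x)" if "i < n" for i
    by (rule annihilates_cong[OF sub[OF that] annihilates_zero sm])
  have "AE x in M. z k x = 0" if "k < n" for k
    using z Lp_le_self by (intro marginals_zero_if_sum_annihilated[OF _ ann that]) (auto simp: marginal_def)
  then show "\<forall>i\<in>{..<n}. Y i = ae_zero M"
    using z by (auto simp: ae_zero_def intro!: ae_class_eqI)
qed

text \<open>
  The projection sends \<open>f\<close> to its marginal part.  Linearity, idempotence and the identification of the
  range come from uniqueness, continuity from the norm bound in the existence statement.
\<close>

theorem marginal_sum_complemented:
  "complemented_in_Lp M p
    (sum_of_subspaces M {..<n} (\<lambda>i. Lp0_sub M p (F i) :: ('a \<Rightarrow> 'k::{euclidean_space, real_normed_field}) set set))"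
proof -
  define Q where "Q X = ae_class M (SOME S. marginal_part (ae_rep X) S)" for X :: "('a \<Rightarrow> 'k) set"
  define K where "K = (\<Sum>i<n. 2 * (\<Sum>j<n. 1 / w j) / (1 - \<theta>) * w i)"
  have K0: "0 \<le> K"
    unfolding K_def using w_pos \<theta>_less_1
    by (intro sum_nonneg mult_nonneg_nonneg divide_nonneg_pos) (auto intro!: sum_nonneg intro: less_imp_le)
  have int: "integrable M f" if "f \<in> Lp_functions M p" for f :: "'a \<Rightarrow> 'k"
    by (rule Lp_le_integrable(1)[OF Lp_le_self[OF that]])
  have ex: "\<exists>S. marginal_part f S" if "f \<in> Lp_functions M p" for f :: "'a \<Rightarrow> 'k"
    using marginal_part_exists[OF Lp_le_self[OF that]] by blast
  have measS: "S \<in> borel_measurable M" if "marginal_part f S" for f S :: "'a \<Rightarrow> 'k"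
    using that by (simp add: marginal_part_def marginal_combination_def)
  have SL: "S \<in> Lp_functions M p" if "marginal_part f S" for f S :: "'a \<Rightarrow> 'k"
    using that marginal_combination_Lp by (auto simp: marginal_part_def)
  have Q_eq: "Q (ae_class M f) = ae_class M S" if f: "f \<in> Lp_functions M p" and S: "marginal_part f S"
    for f S :: "'a \<Rightarrow> 'k"
  proof -
    let ?r = "ae_rep (ae_class M f)"
    have fM: "f \<in> borel_measurable M" by (rule Lp_functions_measurable) fact
    have rL: "?r \<in> Lp_functions M p" by (rule ae_rep_in_Lp_functions) (use f in \<open>simp add: Lp_def\<close>)
    have "marginal_part ?r (SOME S. marginal_part ?r S)" by (rule someI_ex[OF ex[OF rL]])
    then have "AE x in M. (SOME S. marginal_part ?r S) x = S x"
      by (rule marginal_part_unique[OF int[OF rL] _ int[OF f] S ae_rep_ae_class(2)[OF fM]])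
    then show ?thesis unfolding Q_def by (rule ae_class_eqI)
  qed
  have rep: "\<exists>f S. f \<in> Lp_functions M p \<and> X = ae_class M f \<and> marginal_part f S \<and> Q X = ae_class M S"
    if "X \<in> Lp M p" for X :: "('a \<Rightarrow> 'k) set"
    using that ex Q_eq by (fastforce simp: Lp_def)
  have cont: "continuous_map (Lp_topology M p) (Lp_topology M p) Q"
    unfolding Lp_topology_def Metric_space.metric_continuous_map[OF Metric_space_Lp Metric_space_Lp]
  proof (intro conjI ballI allI impI)
    show "Q ` Lp M p \<subseteq> Lp M p" using rep SL by (fastforce simp: Lp_def)
    fix X :: "('a \<Rightarrow> 'k) set" and \<epsilon> :: real assume X: "X \<in> Lp M p" and \<epsilon>: "0 < \<epsilon>"
    have "Lp_norm M p (ae_diff M (Q X) (Q Y)) < \<epsilon>"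
      if Y: "Y \<in> Lp M p" and less: "Lp_norm M p (ae_diff M X Y) < \<epsilon> / (K + 1)" for Y
    proof -
      obtain f S where f: "f \<in> Lp_functions M p" "X = ae_class M f" "marginal_part f S" "Q X = ae_class M S"
        using rep[OF X] by blast
      obtain g T where g: "g \<in> Lp_functions M p" "Y = ae_class M g" "marginal_part g T" "Q Y = ae_class M T"
        using rep[OF Y] by blast
      have fg: "(\<lambda>x. f x - g x) \<in> Lp_functions M p" by (rule Lp_functions_diff) fact+
      obtain U where U: "marginal_part (\<lambda>x. f x - g x) U" "Lp_le M p (K * Lp_seminorm M p (\<lambda>x. f x - g x)) U"
        using marginal_part_exists[OF Lp_le_self[OF fg]] unfolding K_def by blast
      have "marginal_part (\<lambda>x. f x - g x) (\<lambda>x. S x - T x)"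
        using marginal_part_linear[OF int[OF f(1)] f(3) int[OF g(1)] g(3), of 1 "- 1"] by simp
      then have "AE x in M. S x - T x = U x"
        by (rule marginal_part_unique[OF int[OF fg] _ int[OF fg] U(1)]) simp
      then have "ae_class M (\<lambda>x. S x - T x) = ae_class M U" by (rule ae_class_eqI)
      then have "ae_diff M (Q X) (Q Y) = ae_class M U"
        using f(4) g(4) ae_diff_ae_class[OF measS[OF f(3)] measS[OF g(3)]] by simp
      then have "Lp_norm M p (ae_diff M (Q X) (Q Y)) \<le> K * Lp_seminorm M p (\<lambda>x. f x - g x)"
        using Lp_norm_ae_class_le[OF U(2)] by simp
      also have "Lp_seminorm M p (\<lambda>x. f x - g x) = Lp_norm M p (ae_diff M X Y)"
        using ae_diff_ae_class[OF Lp_functions_measurable[OF f(1)] Lp_functions_measurable[OF g(1)]]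
          Lp_norm_ae_class[OF Lp_functions_measurable[OF fg]] f(2) g(2) by simp
      also have "K * Lp_norm M p (ae_diff M X Y) \<le> (K + 1) * Lp_norm M p (ae_diff M X Y)"
        by (intro mult_right_mono) (auto simp: Lp_norm_def Lp_seminorm_nonneg)
      also have "\<dots> < \<epsilon>" using less K0 by (simp add: pos_less_divide_eq mult.commute)
      finally show ?thesis .
    qed
    moreover have "0 < \<epsilon> / (K + 1)" using \<epsilon> K0 by simp
    ultimately show "\<exists>\<delta>>0. \<forall>Y. Y \<in> Lp M p \<and> Lp_norm M p (ae_diff M X Y) < \<delta> \<longrightarrow>
        Lp_norm M p (ae_diff M (Q X) (Q Y)) < \<epsilon>" by blast
  qed
  have "Q (ae_add M X Y) = ae_add M (Q X) (Q Y)" if XY: "X \<in> Lp M p" "Y \<in> Lp M p" for X Y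
  proof -
    obtain f S where f: "f \<in> Lp_functions M p" "X = ae_class M f" "marginal_part f S" "Q X = ae_class M S"
      using rep[OF XY(1)] by blast
    obtain g T where g: "g \<in> Lp_functions M p" "Y = ae_class M g" "marginal_part g T" "Q Y = ae_class M T"
      using rep[OF XY(2)] by blast
    have "marginal_part (\<lambda>x. f x + g x) (\<lambda>x. S x + T x)"
      using marginal_part_linear[OF int[OF f(1)] f(3) int[OF g(1)] g(3), of 1 1] by simp
    then have "Q (ae_class M (\<lambda>x. f x + g x)) = ae_class M (\<lambda>x. S x + T x)"
      by (rule Q_eq[OF Lp_functions_add[OF f(1) g(1)]])
    then show ?thesis
      unfolding f(4) g(4) ae_add_ae_class[OF measS[OF f(3)] measS[OF g(3)]]
      using ae_add_ae_class[OF Lp_functions_measurable[OF f(1)] Lp_functions_measurable[OF g(1)]] f(2) g(2)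
      by simp
  qed
  moreover have "Q (ae_scale M a X) = ae_scale M a (Q X)" if XL: "X \<in> Lp M p" for X a
  proof -
    obtain f S where f: "f \<in> Lp_functions M p" "X = ae_class M f" "marginal_part f S" "Q X = ae_class M S"
      using rep[OF XL] by blast
    have "marginal_part (\<lambda>x. a * f x) (\<lambda>x. a * S x)"
      using marginal_part_linear[OF int[OF f(1)] f(3) int[OF f(1)] f(3), of a 0] by simp
    then have "Q (ae_class M (\<lambda>x. a * f x)) = ae_class M (\<lambda>x. a * S x)"
      by (rule Q_eq[OF Lp_functions_scale[OF f(1)]])
    then show ?thesis
      unfolding f(4) ae_scale_ae_class[OF measS[OF f(3)]]
      using ae_scale_ae_class[OF Lp_functions_measurable[OF f(1)]] f(2) by simp
  qed
  ultimately have lin: "Lp_linear M p Q" by (simp add: Lp_linear_def)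
  have fix_comb: "Q (ae_class M S) = ae_class M S" if "marginal_combination S" for S
    by (rule Q_eq[OF marginal_combination_Lp(1)[OF that] marginal_part_self[OF that]])
  have idem: "Q (Q X) = Q X" if X: "X \<in> Lp M p" for X
  proof -
    obtain f S where "marginal_part f S" "Q X = ae_class M S" using rep[OF X] by blast
    then show ?thesis using fix_comb by (simp add: marginal_part_def)
  qed
  have "Q ` Lp M p = sum_of_subspaces M {..<n} (\<lambda>i. Lp0_sub M p (F i))"
  proof (intro equalityI subsetI)
    fix Y assume "Y \<in> Q ` Lp M p"
    then obtain X where X: "X \<in> Lp M p" "Y = Q X" by blast
    obtain f S where "marginal_part f S" "Q X = ae_class M S" using rep[OF X(1)] by blast
    then show "Y \<in> sum_of_subspaces M {..<n} (\<lambda>i. Lp0_sub M p (F i))"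
      using X(2) by (auto simp: sum_of_marginals_iff marginal_part_def)
  next
    fix Y :: "('a \<Rightarrow> 'k) set" assume "Y \<in> sum_of_subspaces M {..<n} (\<lambda>i. Lp0_sub M p (F i))"
    then obtain S where S: "marginal_combination S" "Y = ae_class M S" by (auto simp: sum_of_marginals_iff)
    then have "Y = Q Y" "Y \<in> Lp M p" using fix_comb marginal_combination_Lp(1) by (auto simp: Lp_def)
    then show "Y \<in> Q ` Lp M p" by (rule image_eqI)
  qed
  then show ?thesis unfolding complemented_in_Lp_def using cont lin idem by blast
qed

end

theorem theorem3p1:
  fixes M :: "'a measure" and F :: "nat \<Rightarrow> 'a measure" and n :: nat and p :: ennreal
  assumes "prob_space M"
    and "n \<ge> 1"
    and "\<And>i. i < n \<Longrightarrow> subalgebra M (F i)"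
    and "1 \<le> p"
    and "spectral_radius (Matrix.mat n n
           (\<lambda>(i, j). complex_of_real (if i = j then 0 else 1 - psi' M (F i) (F j)))) < 1"
  shows
    "(independent_subspaces M {..<n} (\<lambda>i. Lp0_sub M p (F i) :: ('a \<Rightarrow> real) set set) \<and>
      complemented_in_Lp M p
        (sum_of_subspaces M {..<n} (\<lambda>i. Lp0_sub M p (F i) :: ('a \<Rightarrow> real) set set))) \<and>
     (independent_subspaces M {..<n} (\<lambda>i. Lp0_sub M p (F i) :: ('a \<Rightarrow> complex) set set) \<and>
      complemented_in_Lp M p
        (sum_of_subspaces M {..<n} (\<lambda>i. Lp0_sub M p (F i) :: ('a \<Rightarrow> complex) set set)))"
proof -
  interpret prob_space M by fact
  have mix: "mixing_bound (psi' M (F i) (F j)) (F i) (F j)" if "i < n" "j < n" for i j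
    using that assms(3) by (intro mixing_bound_psi')
  obtain w \<theta> where w: "\<And>i. i < n \<Longrightarrow> 0 < w i" and \<theta>: "0 \<le> \<theta>" "\<theta> < 1"
    and le: "\<And>i. i < n \<Longrightarrow> (\<Sum>j<n. (if i = j then 0 else 1 - psi' M (F i) (F j)) * w j) \<le> \<theta> * w i"
    using spectral_radius_less_1_imp_weights[OF _ _ assms(5)] assms(2) mix by (fastforce simp: mixing_bound_def)
  have wt: "(\<Sum>j\<in>{..<n} - {i}. (1 - psi' M (F i) (F j)) * w j) \<le> \<theta> * w i" if i: "i < n" for i
  proof -
    have "(\<Sum>j\<in>{..<n} - {i}. (1 - psi' M (F i) (F j)) * w j)
        = (\<Sum>j\<in>{..<n} - {i}. (if i = j then 0 else 1 - psi' M (F i) (F j)) * w j)"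
      by (rule sum.cong) auto
    also have "\<dots> = (\<Sum>j<n. (if i = j then 0 else 1 - psi' M (F i) (F j)) * w j)"
      using i by (simp add: sum.remove[of "{..<n}" i])
    also have "\<dots> \<le> \<theta> * w i" by (rule le[OF i])
    finally show ?thesis .
  qed
  interpret marginal_system M p F n "\<lambda>i j. psi' M (F i) (F j)" w \<theta>
    using assms(2,4) by unfold_locales (use assms(3) mix w \<theta> wt in auto)
  show ?thesis by (intro conjI marginals_independent marginal_sum_complemented)
qed

end
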